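(* Let $A\in\mathbb{R}^{m\times n}$ have rows $a_1^T,\dots,a_m^T$ with $\|a_i\|=1$ for all $i$, let $b\in\mathbb{R}^m$ be such that $Ax=b$ has a solution, let $\tau\ge 1$ be an integer bounding the delay, and let $\{x_j\}_{j\ge 0}$ be the iterates of the asynchronous randomized Kaczmarz iteration (described in the context) with steplength parameter $\gamma$ and initial point $x_0\in\mathbb{R}^n$. Let $\rho$ be any number greater than $1$ and define $$\psi:=\mu+\frac{2\lambda_{\max}\tau\rho^{\tau}}{m}.$$ Suppose that $\gamma>0$ satisfies the three bounds $$\gamma\le\frac1\psi,\qquad \gamma\le\frac{m(\rho-1)}{2\lambda_{\max}\rho^{\tau+1}},\qquad \gamma\le m\sqrt{\frac{\rho-1}{\rho^{\tau}\left(m\alpha^2+\lambda_{\max}^2\tau\rho^{\tau}\right)}}.$$ Then for any $j\ge 0$, $$\rho^{-1}\,\mathbb{E}(\|Ax_j-b\|^2)\le \mathbb{E}(\|Ax_{j+1}-b\|^2)\le\rho\,\mathbb{E}(\|Ax_j-b\|^2)$$ and $$\mathbb{E}(\|x_j-x_j^*\|^2)\le\left(1-\frac{\lambda_{\min}\gamma}{m}(2-\gamma\psi)\right)^j\|x_0-x_0^*\|^2 .$$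
   Context: Norms: $\|\cdot\|$ is the Euclidean norm for vectors (spectral norm for matrices). For a vector $x$, $\mathrm{supp}(x)$ is the set of indices of its nonzero components and $\|x\|_0=|\mathrm{supp}(x)|$. Quantities attached to $A$: $\theta_i:=\|a_i\|_0$; $\mu:=\max_i\|a_i\|_0$; $P_t$ is the $n\times n$ matrix of all zeros except for a $1$ in position $(t,t)$; $\alpha:=\max_{i,t}\|A\,\theta_i P_t a_i\|$ (over $1\le i\le m$, $1\le t\le n$); $\lambda_{\min}$ is the smallest nonzero eigenvalue of $A^TA$ and $\lambda_{\max}$ is the largest eigenvalue of $A^TA$. For each $j$, $x_j^*$ denotes the Euclidean projection of $x_j$ onto the solution set $\{x: Ax=b\}$. Asynchronous randomized Kaczmarz iteration: several threads share the vector $x$ in common memory, and the counter $j$ is incremented each time a thread updates $x$. Starting from a given $x_0\in\mathbb{R}^n$, at each iteration $j=0,1,2,\dots$: choose $i(j)$ from $\{1,\dots,m\}$ with equal probability; choose $t(j)$ from $\mathrm{supp}(a_{i(j)})$ with equal probability; then set $$x_{j+1}=x_j-\gamma\,\theta_{i(j)}\,P_{t(j)}\,a_{i(j)}\left(a_{i(j)}^Tx_{k(j)}-b_{i(j)}\right).$$ Here $k(j)$ denotes the index of the iterate at which $x$ was read by the thread that updated $x_j$ to $x_{j+1}$. One always has $0\le k(j)\le j$ (with strict inequality $k(j)<j$ when other threads have updated $x$ between the read and the update), and it is assumed that $k(j)\ge j-\tau$ for all $j$, with $\tau\ge1$ an integer. $\mathbb{E}$ denotes the expectation over all random variables $i(0),t(0),i(1),t(1),\dots$.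 *)

theory Defs
  imports "HOL-Probability.Probability"
begin

definition supp :: "real^'n \<Rightarrow> 'n set" where
  "supp x = {t. x $ t \<noteq> 0}"

definition norm0 :: "real^'n \<Rightarrow> nat" where
  "norm0 x = card (supp x)"

definition theta :: "real^'n^'m \<Rightarrow> 'm \<Rightarrow> real" where
  "theta A i = real (norm0 (row i A))"

definition mu :: "real^'n^'m \<Rightarrow> real" where
  "mu A = Max (range (theta A))"

definition unit_mat :: "'n \<Rightarrow> real^'n^'n" where
  "unit_mat t = (\<chi> r c. if r = t \<and> c = t then 1 else 0)"

definition alpha :: "real^'n^'m \<Rightarrow> real" where
  "alpha A = Max (range (\<lambda>(i, t). norm (A *v (theta A i *\<^sub>R (unit_mat t *v row i A)))))"

definition eigenvalues :: "real^'n^'n \<Rightarrow> real set" where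
  "eigenvalues M = {l. \<exists>v. v \<noteq> 0 \<and> M *v v = l *\<^sub>R v}"

text \<open>Only real eigenvalues are considered; for the symmetric matrix
  \<open>transpose A ** A\<close> there are no others.\<close>

definition lambda_max :: "real^'n^'m \<Rightarrow> real" where
  "lambda_max A = Max (eigenvalues (transpose A ** A))"

definition lambda_min :: "real^'n^'m \<Rightarrow> real" where
  "lambda_min A = Min (eigenvalues (transpose A ** A) - {0})"

definition psi :: "real^'n^'m \<Rightarrow> nat \<Rightarrow> real \<Rightarrow> real" where
  "psi A \<tau> \<rho> = mu A + 2 * lambda_max A * real \<tau> * \<rho> ^ \<tau> / real CARD('m)"

definition solutions :: "real^'n^'m \<Rightarrow> real^'m \<Rightarrow> (real^'n) set" where
  "solutions A b = {x. A *v x = b}"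

definition choice_pmf :: "real^'n^'m \<Rightarrow> ('m \<times> 'n) pmf" where
  "choice_pmf A =
     bind_pmf (pmf_of_set UNIV) (\<lambda>i.
     bind_pmf (pmf_of_set (supp (row i A))) (\<lambda>t.
     return_pmf (i, t)))"

text \<open>The pairs \<open>(I j, T j)\<close> are the random choices of row and component. They are independent
  over \<open>j\<close>; within one iteration \<open>T j\<close> depends on \<open>I j\<close>.\<close>

definition random_choices ::
  "'w measure \<Rightarrow> real^'n^'m \<Rightarrow> (nat \<Rightarrow> 'w \<Rightarrow> 'm) \<Rightarrow> (nat \<Rightarrow> 'w \<Rightarrow> 'n) \<Rightarrow> bool" where
  "random_choices M A I T \<longleftrightarrow>
     prob_space.indep_vars M (\<lambda>_. count_space UNIV) (\<lambda>j \<omega>. (I j \<omega>, T j \<omega>)) UNIV \<and>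
     (\<forall>j. distr M (count_space UNIV) (\<lambda>\<omega>. (I j \<omega>, T j \<omega>)) = measure_pmf (choice_pmf A))"

text \<open>Since \<open>k j \<le> j\<close>, the recursion below determines all \<open>X j\<close> on \<open>space M\<close>.
  The delay sequence \<open>k\<close> is not random.\<close>

definition async_kaczmarz ::
  "'w measure \<Rightarrow> real^'n^'m \<Rightarrow> real^'m \<Rightarrow> nat \<Rightarrow> real \<Rightarrow> real^'n \<Rightarrow> (nat \<Rightarrow> nat) \<Rightarrow>
   (nat \<Rightarrow> 'w \<Rightarrow> 'm) \<Rightarrow> (nat \<Rightarrow> 'w \<Rightarrow> 'n) \<Rightarrow> (nat \<Rightarrow> 'w \<Rightarrow> real^'n) \<Rightarrow> bool" where
  "async_kaczmarz M A b \<tau> \<gamma> x0 k I T X \<longleftrightarrow>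
     random_choices M A I T \<and>
     (\<forall>j. k j \<le> j \<and> j \<le> k j + \<tau>) \<and>
     (\<forall>\<omega>\<in>space M. X 0 \<omega> = x0) \<and>
     (\<forall>\<omega>\<in>space M. \<forall>j. X (Suc j) \<omega> =
        X j \<omega> - (\<gamma> * theta A (I j \<omega>) * (row (I j \<omega>) A \<bullet> X (k j) \<omega> - b $ I j \<omega>)) *\<^sub>R
          (unit_mat (T j \<omega>) *v row (I j \<omega>) A))"

end

theory Submission
  imports Defs
begin

text \<open>
  Write \<open>r j = A x\<^sub>j - b\<close> and \<open>e j = E |r j|\<^sup>2\<close>. Given the past, the increment of iteration \<open>j\<close> has
  mean \<open>- (\<gamma>/m) A\<^sup>T r (k j)\<close>. In the expansion of \<open>|r (j+1)|\<^sup>2\<close> the cross term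
  \<open>A\<^sup>T r j \<bullet> A\<^sup>T r (k j)\<close> is at most \<open>lambda_max (|r j|\<^sup>2 + |r (k j)|\<^sup>2) / 2\<close>, which by induction
  shows that \<open>e\<close> decreases at most by the factor \<open>\<rho>\<close> per step. Hence all delayed errors that
  matter are at most \<open>\<rho>\<close> to the power \<open>2\<tau>\<close> times \<open>e j\<close>. Writing \<open>r j\<close> as \<open>r (k j)\<close> plus the
  intermediate increments then bounds the cross term from below, so \<open>e\<close> grows at most by \<open>\<rho>\<close>.

  The same expansion of the squared distance to the solution set gives a decrease by
  \<open>(\<gamma>/m) (2 - \<gamma>\<psi>) e (k j)\<close>. It involves the delayed error, but the expected squared distance is
  nonincreasing, so \<open>e (k j)\<close> is at least \<open>lambda_min\<close> times its value at \<open>j\<close>.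
\<close>

section \<open>Extreme eigenvalues of the Gram matrix\<close>

text \<open>As a simp rule it would turn \<open>transpose A *v x\<close> into \<open>x v* A\<close>;
  the adjoint has to keep the form in which \<open>inner_transpose_mult\<close> moves it.\<close>

declare transpose_matrix_vector [simp del]

lemma inner_transpose_mult:
  fixes A :: "real^'n^'m"
  shows "(transpose A *v x) \<bullet> y = x \<bullet> (A *v y)"
  by (simp add: transpose_matrix_vector dot_lmul_matrix)

text \<open>For small \<open>s\<close> the linear term dominates, so a nonzero \<open>c\<close>
  would make the quadratic negative on one side of \<open>0\<close>.\<close>

lemma nonneg_quadratic_imp_zero:
  fixes c d :: real
  assumes "\<And>s. 2 * s * c + s\<^sup>2 * d \<ge> 0"
  shows "c = 0"
proof (rule ccontr)
  assume "c \<noteq> 0"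
  \<comment> \<open>The sign is opposite to that of \<open>c\<close>, and the size is small enough
    for the linear term to outweigh \<open>s\<^sup>2 * d\<close>; the summand \<open>1\<close>
    covers \<open>d = 0\<close>.\<close>
  define s where "s = - c / (\<bar>d\<bar> + 1)"
  have c: "c = - s * (\<bar>d\<bar> + 1)"
    by (simp add: s_def)
  have "2 * s * c + s\<^sup>2 * d = - (s\<^sup>2 * (2 * \<bar>d\<bar> + 2 - d))"
    by (subst c) (simp add: power2_eq_square algebra_simps)
  moreover have "s\<^sup>2 * (2 * \<bar>d\<bar> + 2 - d) > 0"
    using \<open>c \<noteq> 0\<close> c by (intro mult_pos_pos) auto
  ultimately show False
    using assms[of s] by linarith
qed

text \<open>A minimizer of the Rayleigh quotient on an invariant subspace is an eigenvector. On the
  whole space (with the sign reversed) this controls \<open>lambda_max\<close>, on the orthogonal complement of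
  the kernel it controls \<open>lambda_min\<close>.\<close>

lemma symmetric_min_eigenvector:
  fixes N :: "real^'n^'n"
  assumes sym: "transpose N = N" and S: "subspace S"
    and inv: "\<And>x. x \<in> S \<Longrightarrow> N *v x \<in> S" and u: "u \<in> S" "u \<noteq> 0"
  obtains v l where "v \<in> S" "norm v = 1" "N *v v = l *\<^sub>R v"
    and "\<And>x. x \<in> S \<Longrightarrow> l * (norm x)\<^sup>2 \<le> x \<bullet> (N *v x)"
proof -
  let ?K = "S \<inter> sphere 0 1"
  have "(1 / norm u) *\<^sub>R u \<in> ?K"
    using u S by (simp add: subspace_scale)
  then have "?K \<noteq> {}"
    by blast
  moreover have "compact ?K"
    using closed_subspace[OF S] by (intro closed_Int_compact compact_sphere)
  moreover have "continuous_on ?K (\<lambda>x. x \<bullet> (N *v x))"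
    by (intro continuous_intros)
  ultimately obtain v where vK: "v \<in> ?K" and minK: "\<And>x. x \<in> ?K \<Longrightarrow> v \<bullet> (N *v v) \<le> x \<bullet> (N *v x)"
    using continuous_attains_inf[of ?K "\<lambda>x. x \<bullet> (N *v x)"] by blast
  have v: "v \<in> S" "norm v = 1"
    using vK by auto
  have min: "v \<bullet> (N *v v) \<le> x \<bullet> (N *v x)" if "x \<in> S" "norm x = 1" for x
    using minK that by simp
  define l where "l = v \<bullet> (N *v v)"
  have bound: "l * (norm x)\<^sup>2 \<le> x \<bullet> (N *v x)" if "x \<in> S" for x
  proof (cases "x = 0")
    case False
    have "l \<le> ((1 / norm x) *\<^sub>R x) \<bullet> (N *v ((1 / norm x) *\<^sub>R x))"
      unfolding l_def using that False S by (intro min) (auto simp: subspace_scale)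
    also have "\<dots> = (x \<bullet> (N *v x)) / (norm x)\<^sup>2"
      by (simp add: matrix_vector_mult_scaleR power2_eq_square)
    finally show ?thesis
      using False by (simp add: field_simps)
  qed auto
  \<comment> \<open>First variation: the minimizer is moved in the direction of its own residual
    \<open>w\<close>, which stays in \<open>S\<close> by invariance. The linear coefficient in
    \<open>s\<close> is then \<open>2 * (w \<bullet> w)\<close>.\<close>
  define w where "w = N *v v - l *\<^sub>R v"
  have "w \<in> S"
    unfolding w_def using v S inv by (intro subspace_diff subspace_scale) auto
  have "w \<bullet> w = 0"
  proof (rule nonneg_quadratic_imp_zero)
    fix s :: real
    have 1: "l * (norm (v + s *\<^sub>R w))\<^sup>2 = l + 2 * s * l * (v \<bullet> w) + s\<^sup>2 * l * (w \<bullet> w)"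
    proof -
      have "v \<bullet> v = 1"
        using v by (simp add: norm_eq_1)
      then show ?thesis
        unfolding power2_norm_eq_inner
        by (simp add: inner_simps inner_commute[of w v] power2_eq_square algebra_simps)
    qed
    have c: "v \<bullet> (N *v w) = w \<bullet> (N *v v)"
      using inner_transpose_mult[of N v w] sym by (simp add: inner_commute)
    have 2: "(v + s *\<^sub>R w) \<bullet> (N *v (v + s *\<^sub>R w)) = l + 2 * s * (w \<bullet> (N *v v)) + s\<^sup>2 * (w \<bullet> (N *v w))"
      by (simp add: l_def inner_simps matrix_vector_mult_scaleR matrix_vector_right_distrib c
          power2_eq_square algebra_simps)
    have 3: "w \<bullet> w = w \<bullet> (N *v v) - l * (v \<bullet> w)"
      by (subst (2) w_def) (simp add: inner_simps inner_commute)
    have "l * (norm (v + s *\<^sub>R w))\<^sup>2 \<le> (v + s *\<^sub>R w) \<bullet> (N *v (v + s *\<^sub>R w))"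
      using \<open>w \<in> S\<close> v S by (intro bound subspace_add subspace_scale) auto
    then show "2 * s * (w \<bullet> w) + s\<^sup>2 * (w \<bullet> (N *v w) - l * (w \<bullet> w)) \<ge> 0"
      unfolding 1 2 by (subst 3) (simp add: algebra_simps)
  qed
  then have "N *v v = l *\<^sub>R v"
    by (simp add: w_def)
  then show ?thesis
    using that v bound by blast
qed

lemma eigenvaluesI:
  assumes "norm v = 1" "N *v v = l *\<^sub>R v"
  shows "l \<in> eigenvalues N"
  using assms unfolding eigenvalues_def by (auto intro!: exI[of _ v])

text \<open>Eigenvectors of different eigenvalues are orthogonal, and pairwise orthogonal sets are
  finite. Finiteness gives \<open>Max\<close> and \<open>Min\<close> in \<open>lambda_max\<close>
  and \<open>lambda_min\<close> their meaning.\<close>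

lemma finite_eigenvalues_symmetric:
  fixes N :: "real^'n^'n"
  assumes sym: "transpose N = N"
  shows "finite (eigenvalues N)"
proof -
  have "\<forall>l\<in>eigenvalues N. \<exists>v. v \<noteq> 0 \<and> N *v v = l *\<^sub>R v"
    by (auto simp: eigenvalues_def)
  then obtain v where v: "\<And>l. l \<in> eigenvalues N \<Longrightarrow> v l \<noteq> 0 \<and> N *v v l = l *\<^sub>R v l"
    by metis
  have orth: "v l \<bullet> v l' = 0" if "l \<in> eigenvalues N" "l' \<in> eigenvalues N" "l \<noteq> l'" for l l'
  proof -
    have "l * (v l \<bullet> v l') = l' * (v l \<bullet> v l')"
      using inner_transpose_mult[of N "v l" "v l'"] v that sym by simp
    with that show ?thesis by simp
  qed
  have "inj_on v (eigenvalues N)"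
    using v orth by (intro inj_onI) (metis inner_eq_zero_iff)
  moreover have "finite (v ` eigenvalues N)"
    using orth by (intro pairwise_orthogonal_imp_finite)
      (auto simp: pairwise_def orthogonal_def)
  ultimately show ?thesis
    by (simp add: finite_image_iff)
qed

context
  fixes A :: "real^'n^'m"
begin

lemma symmetric_gram: "transpose (transpose A ** A) = transpose A ** A"
  by (simp add: matrix_transpose_mul transpose_transpose)

lemma inner_gram: "x \<bullet> ((transpose A ** A) *v y) = (A *v x) \<bullet> (A *v y)"
  by (metis inner_commute inner_transpose_mult matrix_vector_mul_assoc)

lemma eigenvalue_gram_nonneg:
  assumes "l \<in> eigenvalues (transpose A ** A)"
  shows "l \<ge> 0"
proof -
  obtain v where v: "v \<noteq> 0" "(transpose A ** A) *v v = l *\<^sub>R v"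
    using assms by (auto simp: eigenvalues_def)
  have "l * (v \<bullet> v) = (A *v v) \<bullet> (A *v v)"
    using inner_gram[of v v] v by simp
  then show ?thesis
    using v by (metis inner_ge_zero inner_gt_zero_iff mult_less_0_iff not_le)
qed

lemma norm_mult_le_lambda_max: "(norm (A *v x))\<^sup>2 \<le> lambda_max A * (norm x)\<^sup>2"
proof -
  let ?G = "transpose A ** A"
  have neg: "(- ?G) *v y = - (?G *v y)" for y
    by (metis add_diff_cancel_left' diff_0 matrix_vector_mult_0 matrix_vector_mult_diff_rdistrib)
  have symm: "transpose (- ?G) = - ?G"
    using symmetric_gram by (simp add: transpose_def vec_eq_iff)
  \<comment> \<open>The least value of the negated quotient is minus an eigenvalue of
    \<open>?G\<close>. The axis vector only witnesses that the space is not zero.\<close>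
  obtain v l where v: "norm v = 1" "(- ?G) *v v = l *\<^sub>R v"
    and l: "\<And>x. l * (norm x)\<^sup>2 \<le> x \<bullet> ((- ?G) *v x)"
    by (rule symmetric_min_eigenvector[OF symm subspace_UNIV, of "axis undefined 1"])
       (auto simp: axis_eq_0_iff)
  have "?G *v v = (- l) *\<^sub>R v"
    using v(2) unfolding neg by (metis minus_minus scaleR_minus_left)
  then have "- l \<in> eigenvalues ?G"
    using v(1) by (rule eigenvaluesI[rotated])
  then have "- l \<le> lambda_max A"
    unfolding lambda_max_def using finite_eigenvalues_symmetric[OF symmetric_gram] by simp
  then have "- l * (norm x)\<^sup>2 \<le> lambda_max A * (norm x)\<^sup>2"
    by (rule mult_right_mono) simp
  then show ?thesis
    using l[of x] inner_gram[of x x] unfolding neg by (simp add: power2_norm_eq_inner)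
qed

text \<open>With \<open>z = transpose A *v y\<close>, Cauchy-Schwarz gives
  \<open>(norm z)\<^sup>2 \<le> norm y * norm (A *v z)\<close>; squaring, bounding
  \<open>A *v z\<close> and cancelling \<open>(norm z)\<^sup>2\<close> leaves the claim.\<close>

lemma norm_transpose_mult_le_lambda_max:
  "(norm (transpose A *v y))\<^sup>2 \<le> lambda_max A * (norm y)\<^sup>2"
proof (cases "transpose A *v y = 0")
  case True
  have "0 \<le> lambda_max A * (norm (axis undefined 1 :: real^'n))\<^sup>2"
    using norm_mult_le_lambda_max[of "axis undefined 1"] zero_le_power2 order_trans by blast
  then show ?thesis
    using True by simp
next
  case False
  let ?z = "transpose A *v y"
  have "(norm ?z)\<^sup>2 \<le> norm y * norm (A *v ?z)"
    using norm_cauchy_schwarz[of y "A *v ?z"] by (simp add: power2_norm_eq_inner inner_transpose_mult)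
  then have "((norm ?z)\<^sup>2)\<^sup>2 \<le> (norm y * norm (A *v ?z))\<^sup>2"
    by (rule power_mono) simp
  also have "\<dots> \<le> (norm y)\<^sup>2 * (lambda_max A * (norm ?z)\<^sup>2)"
    unfolding power_mult_distrib by (intro mult_left_mono norm_mult_le_lambda_max) simp
  finally have "(norm ?z)\<^sup>2 * (norm ?z)\<^sup>2 \<le> (lambda_max A * (norm y)\<^sup>2) * (norm ?z)\<^sup>2"
    by (simp add: power2_eq_square algebra_simps)
  then show ?thesis
    by (rule mult_right_le_imp_le) (use False in simp)
qed

lemma lambda_max_pos:
  assumes "A \<noteq> 0"
  shows "lambda_max A > 0"
proof -
  obtain x where x: "A *v x \<noteq> 0"
    using assms matrix_eq[of A 0] by auto
  then have "0 < lambda_max A * (norm x)\<^sup>2"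
    using norm_mult_le_lambda_max[of x] by (smt (verit) zero_less_norm_iff zero_less_power)
  then show ?thesis
    by (simp add: zero_less_mult_iff)
qed

text \<open>\<open>Min\<close> says nothing about an empty set; \<open>A \<noteq> 0\<close> makes
  \<open>lambda_max A\<close> a nonzero eigenvalue, so the set is inhabited.\<close>

lemma lambda_min_nonneg:
  assumes "A \<noteq> 0"
  shows "lambda_min A \<ge> 0"
proof -
  let ?E = "eigenvalues (transpose A ** A)"
  have fin: "finite ?E"
    by (rule finite_eigenvalues_symmetric[OF symmetric_gram])
  obtain v l where "norm v = 1" "(transpose A ** A) *v v = l *\<^sub>R v"
    by (rule symmetric_min_eigenvector[OF symmetric_gram subspace_UNIV, of "axis undefined 1"])
       (auto simp: axis_eq_0_iff)
  then have "?E \<noteq> {}"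
    using eigenvaluesI by blast
  then have "lambda_max A \<in> ?E - {0}"
    using Max_in[OF fin] lambda_max_pos[OF assms] by (auto simp: lambda_max_def)
  then have "lambda_min A \<in> ?E - {0}"
    unfolding lambda_min_def using fin by (intro Min_in) auto
  then show ?thesis
    using eigenvalue_gram_nonneg by auto
qed

text \<open>The orthogonal complement \<open>S\<close> of the kernel is invariant under the Gram
  matrix. The least eigenvalue on it is not \<open>0\<close>, since its eigenvector would lie in the
  kernel and be orthogonal to itself.\<close>

lemma lambda_min_le_norm_mult:
  assumes y: "\<And>v. A *v v = 0 \<Longrightarrow> y \<bullet> v = 0"
  shows "lambda_min A * (norm y)\<^sup>2 \<le> (norm (A *v y))\<^sup>2"
proof (cases "y = 0")
  case False
  let ?G = "transpose A ** A"
  define S where "S = {y. \<forall>v. A *v v = 0 \<longrightarrow> y \<bullet> v = 0}"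
  have S: "subspace S"
    by (auto simp: S_def subspace_def inner_simps)
  have inv: "?G *v x \<in> S" for x
    by (simp add: S_def inner_commute[of "?G *v x"] inner_gram)
  have "y \<in> S"
    using y by (simp add: S_def)
  obtain v l where v: "v \<in> S" "norm v = 1" "?G *v v = l *\<^sub>R v"
    and l: "\<And>x. x \<in> S \<Longrightarrow> l * (norm x)\<^sup>2 \<le> x \<bullet> (?G *v x)"
    using symmetric_min_eigenvector[OF symmetric_gram S inv \<open>y \<in> S\<close> False] by blast
  have "l \<noteq> 0"
  proof
    assume "l = 0"
    then have "A *v v = 0"
      using inner_gram[of v v] v(3) by simp
    then show False
      using v by (auto simp: S_def)
  qed
  moreover have "l \<in> eigenvalues ?G"
    using v by (blast intro: eigenvaluesI)
  ultimately have "lambda_min A \<le> l"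
    unfolding lambda_min_def using finite_eigenvalues_symmetric[OF symmetric_gram] by simp
  then have "lambda_min A * (norm y)\<^sup>2 \<le> l * (norm y)\<^sup>2"
    by (rule mult_right_mono) simp
  also have "\<dots> \<le> (norm (A *v y))\<^sup>2"
    using l[OF \<open>y \<in> S\<close>] inner_gram[of y y] by (simp add: power2_norm_eq_inner)
  finally show ?thesis .
qed simp

lemma closest_point_solutions:
  assumes "solutions A b \<noteq> {}"
  shows closest_point_in_solutions: "A *v closest_point (solutions A b) x = b"
    and closest_point_solutions_orthogonal:
      "A *v v = 0 \<Longrightarrow> (x - closest_point (solutions A b) x) \<bullet> v = 0"
    and closed_solutions: "closed (solutions A b)"
proof -
  have conv: "convex (solutions A b)"
    by (auto simp: solutions_def convex_def matrix_vector_right_distrib matrix_vector_mult_scaleR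
        simp flip: scaleR_left_distrib)
  show cl: "closed (solutions A b)"
    unfolding solutions_def by (intro closed_Collect_eq continuous_intros)
  let ?p = "closest_point (solutions A b) x"
  show p: "A *v ?p = b"
    using closest_point_in_set[OF cl assms, of x] by (simp add: solutions_def)
  assume v: "A *v v = 0"
  \<comment> \<open>\<open>?p + s *\<^sub>R v\<close> is again a solution, so the variational
    inequality of the projection holds for both signs of \<open>s\<close>, which forces
    equality.\<close>
  have "(x - ?p) \<bullet> (s *\<^sub>R v) \<le> 0" for s :: real
    using closest_point_dot[OF conv cl, of "?p + s *\<^sub>R v" x] p v
    by (simp add: solutions_def matrix_vector_right_distrib matrix_vector_mult_scaleR)
  from this[of 1] this[of "-1"] show "(x - ?p) \<bullet> v = 0"
    by simp
qed

end

section \<open>Mean and size of one increment\<close>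

text \<open>The factor \<open>theta A i\<close> undoes the uniform choice of \<open>t\<close> from
  the support: averaged over \<open>t\<close>, this direction is \<open>row i A\<close>.\<close>

definition update_dir :: "real^'n^'m \<Rightarrow> 'm \<Rightarrow> 'n \<Rightarrow> real^'n" where
  "update_dir A i t = theta A i *\<^sub>R (unit_mat t *v row i A)"

lemma update_dir_eq_axis: "update_dir A i t = axis t (theta A i * row i A $ t)"
  by (simp add: update_dir_def unit_mat_def matrix_vector_mult_def vec_eq_iff axis_def sum.delta'
      if_distrib[of "\<lambda>x. x * _"] if_distrib[of "\<lambda>x. _ * x"] cong: if_cong conj_cong)

lemma theta_nonneg: "theta A i \<ge> 0"
  by (simp add: theta_def)

lemma theta_le_mu: "theta A i \<le> mu A"
  unfolding mu_def by (intro Max_ge) auto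

lemma norm_mult_dir_le_alpha: "norm (A *v update_dir A i t) \<le> alpha A"
  unfolding alpha_def update_dir_def by (intro Max_ge) (auto intro!: image_eqI[of _ _ "(i, t)"])

lemma sum_supp: "(\<Sum>t\<in>supp x. f t * x $ t) = (\<Sum>t\<in>UNIV. f t * x $ t)"
  by (rule sum.mono_neutral_left) (auto simp: supp_def)

lemma sum_inner_dir:
  "(\<Sum>t\<in>supp (row i A). y \<bullet> update_dir A i t) = theta A i * (A *v y) $ i"
proof -
  have "(\<Sum>t\<in>supp (row i A). y \<bullet> update_dir A i t)
      = (\<Sum>t\<in>supp (row i A). (theta A i * y $ t) * row i A $ t)"
    by (simp add: update_dir_eq_axis inner_axis mult_ac)
  also have "\<dots> = theta A i * (row i A \<bullet> y)"
    unfolding sum_supp by (simp add: inner_vec_def sum_distrib_left mult_ac)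
  finally show ?thesis
    by (simp add: matrix_vector_mul_component row_def inner_vec_def matrix_vector_mult_def)
qed

text \<open>Dividing by the number \<open>theta A i\<close> of choices of \<open>t\<close> leaves,
  for a unit row, one factor \<open>theta A i\<close>; this is where \<open>mu A\<close>
  enters.\<close>

lemma sum_norm_dir:
  "(\<Sum>t\<in>supp (row i A). (norm (update_dir A i t))\<^sup>2) = (theta A i)\<^sup>2 * (norm (row i A))\<^sup>2"
proof -
  have "(\<Sum>t\<in>supp (row i A). (norm (update_dir A i t))\<^sup>2)
      = (\<Sum>t\<in>supp (row i A). ((theta A i)\<^sup>2 * row i A $ t) * row i A $ t)"
    unfolding update_dir_eq_axis power2_norm_eq_inner inner_axis_axis
    by (simp add: power2_eq_square mult_ac)
  also have "\<dots> = (theta A i)\<^sup>2 * (norm (row i A))\<^sup>2"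
    unfolding sum_supp by (simp add: power2_norm_eq_inner inner_vec_def sum_distrib_left mult_ac)
  finally show ?thesis .
qed

lemma expectation_choice_pmf:
  fixes A :: "real^'n^'m" and g :: "'m \<times> 'n \<Rightarrow> real"
  assumes "\<And>i. row i A \<noteq> 0"
  shows "measure_pmf.expectation (choice_pmf A) g
    = (\<Sum>i\<in>UNIV. (\<Sum>t\<in>supp (row i A). g (i, t)) / theta A i) / real CARD('m)"
proof -
  have ne: "supp (row i A) \<noteq> {}" for i
    using assms[of i] by (auto simp: supp_def vec_eq_iff)
  have "measure_pmf.expectation (pmf_of_set (supp (row i A)) \<bind> (\<lambda>t. return_pmf (i, t))) g
      = (\<Sum>t\<in>supp (row i A). g (i, t)) / theta A i" for i
    by (subst pmf_expectation_bind_pmf_of_set)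
      (use ne[of i] in \<open>simp_all add: theta_def norm0_def sum_divide_distrib divide_inverse mult_ac sum_distrib_left\<close>)
  then show ?thesis
    unfolding choice_pmf_def
    by (subst pmf_expectation_bind_pmf_of_set)
      (simp_all add: sum_divide_distrib divide_inverse mult_ac sum_distrib_left)
qed

section \<open>The iterates as functions of a finite random history\<close>

locale async_rk = prob_space M for M :: "'w measure" +
  fixes A :: "real^'n^'m" and b :: "real^'m" and \<tau> :: nat and \<gamma> :: real and x0 :: "real^'n"
    and k :: "nat \<Rightarrow> nat" and I :: "nat \<Rightarrow> 'w \<Rightarrow> 'm" and T :: "nat \<Rightarrow> 'w \<Rightarrow> 'n"
    and X :: "nat \<Rightarrow> 'w \<Rightarrow> real^'n"
  assumes unit_rows: "\<And>i. norm (row i A) = 1"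
    and async: "async_kaczmarz M A b \<tau> \<gamma> x0 k I T X"
begin

definition Z :: "nat \<Rightarrow> 'w \<Rightarrow> 'm \<times> 'n" where
  "Z d \<omega> = (I d \<omega>, T d \<omega>)"

text \<open>Cutting off with \<open>restrict\<close> makes \<open>hist d\<close> a point of a finite
  product space, to which independence of disjoint index blocks applies.\<close>

definition hist :: "nat \<Rightarrow> 'w \<Rightarrow> nat \<Rightarrow> 'm \<times> 'n" where
  "hist d \<omega> = restrict (\<lambda>i. Z i \<omega>) {..<d}"

text \<open>\<open>past d W\<close> says that \<open>W\<close> depends only on the choices made before iteration \<open>d\<close>. It replaces
  the filtration, and since there are finitely many histories it also yields integrability.\<close>

definition past :: "nat \<Rightarrow> ('w \<Rightarrow> 'a) \<Rightarrow> bool" where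
  "past d W \<longleftrightarrow> (\<exists>F. \<forall>\<omega>\<in>space M. W \<omega> = F (hist d \<omega>))"

definition res :: "nat \<Rightarrow> 'w \<Rightarrow> real^'m" where
  "res d \<omega> = A *v X d \<omega> - b"

definition err :: "nat \<Rightarrow> real" where
  "err d = expectation (\<lambda>\<omega>. (norm (res d \<omega>))\<^sup>2)"

lemma row_nonzero: "row i A \<noteq> 0"
  using unit_rows[of i] by auto

lemma theta_pos: "theta A i > 0"
  using row_nonzero[of i] by (auto simp: theta_def norm0_def card_gt_0_iff supp_def vec_eq_iff)

lemma A_nonzero: "A \<noteq> 0"
  using row_nonzero by (auto simp: row_def vec_eq_iff)

lemma delay: "k d \<le> d" "d \<le> k d + \<tau>"
  using async by (auto simp: async_kaczmarz_def)

lemma indep_Z: "indep_vars (\<lambda>_. count_space UNIV) Z UNIV"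
  and distr_Z: "distr M (count_space UNIV) (Z d) = measure_pmf (choice_pmf A)"
  using async by (auto simp: async_kaczmarz_def random_choices_def Z_def[abs_def])

lemma X_0: "\<omega> \<in> space M \<Longrightarrow> X 0 \<omega> = x0"
  using async by (auto simp: async_kaczmarz_def)

lemma X_Suc:
  assumes "\<omega> \<in> space M"
  shows "X (Suc d) \<omega> - X d \<omega> =
    - (\<gamma> * res (k d) \<omega> $ fst (Z d \<omega>)) *\<^sub>R update_dir A (fst (Z d \<omega>)) (snd (Z d \<omega>))"
proof -
  have "row i A \<bullet> y = (A *v y) $ i" for i y
    by (simp add: row_def inner_vec_def matrix_vector_mult_def)
  then show ?thesis
    using async assms by (simp add: async_kaczmarz_def res_def update_dir_def Z_def mult_ac)
qed

lemma past_const: "past d (\<lambda>_. c)"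
  by (auto simp: past_def)

lemma past_comp: "past d U \<Longrightarrow> past d (\<lambda>\<omega>. f (U \<omega>))"
  unfolding past_def
proof (elim exE)
  fix F
  assume "\<forall>\<omega>\<in>space M. U \<omega> = F (hist d \<omega>)"
  then show "\<exists>H. \<forall>\<omega>\<in>space M. f (U \<omega>) = H (hist d \<omega>)"
    by (intro exI[of _ "\<lambda>h. f (F h)"]) auto
qed

lemma past_Pair: "past d U \<Longrightarrow> past d V \<Longrightarrow> past d (\<lambda>\<omega>. (U \<omega>, V \<omega>))"
  unfolding past_def
proof (elim exE)
  fix F G
  assume "\<forall>\<omega>\<in>space M. U \<omega> = F (hist d \<omega>)" "\<forall>\<omega>\<in>space M. V \<omega> = G (hist d \<omega>)"
  then show "\<exists>H. \<forall>\<omega>\<in>space M. (U \<omega>, V \<omega>) = H (hist d \<omega>)"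
    by (intro exI[of _ "\<lambda>h. (F h, G h)"]) auto
qed

lemma past_comp2: "past d U \<Longrightarrow> past d V \<Longrightarrow> past d (\<lambda>\<omega>. f (U \<omega>) (V \<omega>))"
  using past_comp[OF past_Pair, of d U V "\<lambda>(u, v). f u v"] by simp

lemma past_cong:
  "past d U \<Longrightarrow> (\<And>\<omega>. \<omega> \<in> space M \<Longrightarrow> U \<omega> = V \<omega>) \<Longrightarrow> past d V"
  by (auto simp: past_def)

lemma past_mono:
  assumes "past d U" "d \<le> d'"
  shows "past d' U"
proof -
  obtain F where F: "\<forall>\<omega>\<in>space M. U \<omega> = F (hist d \<omega>)"
    using assms by (auto simp: past_def)
  have "hist d \<omega> = restrict (hist d' \<omega>) {..<d}" for \<omega>
    using assms(2) by (auto simp: hist_def restrict_def fun_eq_iff)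
  with F show ?thesis
    unfolding past_def by (intro exI[of _ "\<lambda>h. F (restrict h {..<d})"]) auto
qed

lemma past_Z: "past (Suc d) (Z d)"
  unfolding past_def by (intro exI[of _ "\<lambda>h. h d"]) (simp add: hist_def)

text \<open>Strong induction: the step to \<open>Suc i\<close> reads the choice \<open>Z i\<close>
  and the iterates \<open>X i\<close> and \<open>X (k i)\<close>, all available because
  \<open>k i \<le> i\<close>.\<close>

lemma past_X: "past d (X d)"
proof (induction d rule: less_induct)
  case (less d)
  show ?case
  proof (cases d)
    case 0
    show ?thesis
      by (rule past_cong[OF past_const[of _ x0]]) (simp add: 0 X_0)
  next
    case (Suc i)
    have *: "past d (X i')" if "i' \<le> i" for i'
      by (rule past_mono[OF less]) (use that Suc in auto)
    have "past d (Z i)"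
      using past_Z[of i] by (simp add: Suc)
    from past_comp2[OF past_Pair[OF *[OF order_refl] *[OF delay(1)]] this]
    have "past d (\<lambda>\<omega>. (\<lambda>(x, y) z. x - (\<gamma> * (A *v y - b) $ fst z) *\<^sub>R update_dir A (fst z) (snd z))
        (X i \<omega>, X (k i) \<omega>) (Z i \<omega>))" .
    then show ?thesis
    proof (rule past_cong)
      fix \<omega> assume "\<omega> \<in> space M"
      from X_Suc[OF this, of i] show "(\<lambda>(x, y) z. x - (\<gamma> * (A *v y - b) $ fst z) *\<^sub>R update_dir A (fst z) (snd z))
        (X i \<omega>, X (k i) \<omega>) (Z i \<omega>) = X d \<omega>"
        by (simp add: Suc res_def algebra_simps)
    qed
  qed
qed

lemma past_X': "i \<le> d \<Longrightarrow> past d (X i)"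
  using past_X past_mono by blast

lemma past_res: "i \<le> d \<Longrightarrow> past d (res i)"
  unfolding res_def[abs_def] by (rule past_comp[OF past_X'])

text \<open>Finitely many indices and finitely many choices: the product is a counting space on a
  finite set, where every function is measurable.\<close>

lemma measurable_on_histories:
  fixes F :: "(nat \<Rightarrow> 'm \<times> 'n) \<Rightarrow> real"
  shows "F \<in> borel_measurable (PiM {..<d} (\<lambda>_. count_space UNIV))"
  by (subst count_space_PiM_finite) auto

lemma measurable_hist: "hist d \<in> measurable M (PiM {..<d} (\<lambda>_. count_space UNIV))"
  unfolding hist_def using indep_Z by (intro measurable_restrict) (auto simp: indep_vars_def)

lemma integrable_past:
  fixes W :: "'w \<Rightarrow> real"
  assumes "past d W"
  shows "integrable M W"
proof -
  obtain F where F: "\<And>\<omega>. \<omega> \<in> space M \<Longrightarrow> W \<omega> = F (hist d \<omega>)"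
    using assms by (auto simp: past_def)
  let ?H = "PiE {..<d} (\<lambda>_. UNIV :: ('m \<times> 'n) set)"
  have fin: "finite ?H"
    by (intro finite_PiE) auto
  have "\<bar>F (hist d \<omega>)\<bar> \<le> (\<Sum>h\<in>?H. \<bar>F h\<bar>)" for \<omega>
    using fin by (intro member_le_sum[of _ _ "\<lambda>h. \<bar>F h\<bar>"]) (auto simp: hist_def)
  then have "integrable M (\<lambda>\<omega>. F (hist d \<omega>))"
    using measurable_compose[OF measurable_hist measurable_on_histories]
    by (intro integrable_const_bound[where B = "\<Sum>h\<in>?H. \<bar>F h\<bar>"]) auto
  then show ?thesis
    using F by (simp cong: Bochner_Integration.integrable_cong)
qed

text \<open>\<open>Z d\<close> is independent of the past, so the inner expectation plays the role
  of the conditional one. As \<open>Z d\<close> has finitely many values, it suffices to treat the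
  indicator of each value.\<close>

lemma expectation_fresh_choice:
  fixes g :: "'a \<Rightarrow> 'm \<times> 'n \<Rightarrow> real"
  assumes V: "past d V"
  shows "expectation (\<lambda>\<omega>. g (V \<omega>) (Z d \<omega>))
    = expectation (\<lambda>\<omega>. measure_pmf.expectation (choice_pmf A) (g (V \<omega>)))"
proof -
  let ?ind = "\<lambda>z \<omega>. indicator {z} (Z d \<omega>) :: real"
  obtain F where F: "\<And>\<omega>. \<omega> \<in> space M \<Longrightarrow> V \<omega> = F (hist d \<omega>)"
    using V by (auto simp: past_def)
  have pg: "past d (\<lambda>\<omega>. g (V \<omega>) z)" for z
    using V by (rule past_comp)
  have pind: "past (Suc d) (?ind z)" for z
    using past_Z by (rule past_comp)
  have prod: "expectation (\<lambda>\<omega>. g (V \<omega>) z * ?ind z \<omega>)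
      = pmf (choice_pmf A) z * expectation (\<lambda>\<omega>. g (V \<omega>) z)" for z
  proof -
    \<comment> \<open>The index blocks \<open>{..<d}\<close> and \<open>{d}\<close> are disjoint,
      which separates the history from the fresh choice.\<close>
    have "indep_var (PiM {..<d} (\<lambda>_. count_space UNIV)) (hist d)
        (PiM {d} (\<lambda>_. count_space UNIV)) (\<lambda>\<omega>. restrict (\<lambda>i. Z i \<omega>) {d})"
      unfolding hist_def by (rule indep_var_restrict[OF indep_Z]) auto
    then have "indep_var borel ((\<lambda>h. g (F h) z) \<circ> hist d)
        borel ((\<lambda>h. indicator {z} (h d)) \<circ> (\<lambda>\<omega>. restrict (\<lambda>i. Z i \<omega>) {d}) :: 'w \<Rightarrow> real)"
      by (rule indep_var_compose[OF _ measurable_on_histories])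
        (auto intro!: measurable_compose[OF measurable_component_singleton])
    then have ind: "indep_var borel (\<lambda>\<omega>. g (F (hist d \<omega>)) z) borel (?ind z)"
      by (simp add: o_def)
    have int: "integrable M (\<lambda>\<omega>. g (F (hist d \<omega>)) z)"
      using integrable_past[OF pg[of z]] F by (simp cong: Bochner_Integration.integrable_cong)
    have "expectation (?ind z) = measure (distr M (count_space UNIV) (Z d)) {z}"
    proof -
      have meas: "Z d \<in> measurable M (count_space UNIV)"
        using indep_Z by (auto simp: indep_vars_def)
      have "expectation (?ind z) = expectation (indicator (Z d -` {z} \<inter> space M))"
        by (intro Bochner_Integration.integral_cong) (auto simp: indicator_def)
      also have "\<dots> = prob (Z d -` {z} \<inter> space M)"
        by simp
      finally show ?thesis
        using meas by (simp add: measure_distr)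
    qed
    also have "\<dots> = pmf (choice_pmf A) z"
      by (simp add: distr_Z pmf.rep_eq)
    finally have "expectation (\<lambda>\<omega>. g (F (hist d \<omega>)) z * ?ind z \<omega>)
      = pmf (choice_pmf A) z * expectation (\<lambda>\<omega>. g (F (hist d \<omega>)) z)"
      using indep_var_lebesgue_integral[OF ind int integrable_past[OF pind]] by simp
    then show ?thesis
      using F by (simp cong: Bochner_Integration.integral_cong)
  qed
  have "g v y = (\<Sum>z\<in>UNIV. g v z * indicator {z} y)" for v y
    by (simp add: indicator_def)
  then have "expectation (\<lambda>\<omega>. g (V \<omega>) (Z d \<omega>))
      = expectation (\<lambda>\<omega>. \<Sum>z\<in>UNIV. g (V \<omega>) z * ?ind z \<omega>)"
    by (intro Bochner_Integration.integral_cong) auto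
  also have "\<dots> = (\<Sum>z\<in>UNIV. expectation (\<lambda>\<omega>. g (V \<omega>) z * ?ind z \<omega>))"
    by (intro Bochner_Integration.integral_sum integrable_past[OF past_comp2[OF past_mono[OF pg] pind]]) simp
  also have "\<dots> = (\<Sum>z\<in>UNIV. expectation (\<lambda>\<omega>. pmf (choice_pmf A) z * g (V \<omega>) z))"
    by (simp add: prod)
  also have "\<dots> = expectation (\<lambda>\<omega>. \<Sum>z\<in>UNIV. pmf (choice_pmf A) z * g (V \<omega>) z)"
    by (intro Bochner_Integration.integral_sum[symmetric] integrable_mult_right integrable_past[OF pg])
  also have "\<dots> = expectation (\<lambda>\<omega>. measure_pmf.expectation (choice_pmf A) (g (V \<omega>)))"
    by (simp add: integral_measure_pmf[of UNIV])
  finally show ?thesis .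
qed

text \<open>Averaging over \<open>t\<close> turns \<open>update_dir\<close> into row
  \<open>i\<close>, and the sum over \<open>i\<close> assembles \<open>A *v V\<close>.
  \<open>V\<close> may be random as long as it is determined before iteration
  \<open>d\<close>.\<close>

lemma expectation_inner_increment:
  assumes V: "past d V"
  shows "expectation (\<lambda>\<omega>. V \<omega> \<bullet> (X (Suc d) \<omega> - X d \<omega>))
    = - (\<gamma> / real CARD('m)) * expectation (\<lambda>\<omega>. res (k d) \<omega> \<bullet> (A *v V \<omega>))"
proof -
  define g where "g = (\<lambda>(v, r :: real^'m) (i, t). - \<gamma> * r $ i * (v \<bullet> update_dir A i t))"
  have mean: "measure_pmf.expectation (choice_pmf A) (g (v, r)) = - (\<gamma> / real CARD('m)) * (r \<bullet> (A *v v))"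
    for v r
  proof -
    have "(\<Sum>t\<in>supp (row i A). g (v, r) (i, t)) / theta A i = - \<gamma> * (r $ i * (A *v v) $ i)" for i
    proof -
      have "(\<Sum>t\<in>supp (row i A). g (v, r) (i, t)) = - \<gamma> * r $ i * (\<Sum>t\<in>supp (row i A). v \<bullet> update_dir A i t)"
        unfolding g_def by (simp add: sum_distrib_left)
      then show ?thesis
        using theta_pos[of i] by (simp add: sum_inner_dir)
    qed
    then have "measure_pmf.expectation (choice_pmf A) (g (v, r))
        = (\<Sum>i\<in>UNIV. - \<gamma> * (r $ i * (A *v v) $ i)) / real CARD('m)"
      by (simp only: expectation_choice_pmf[OF row_nonzero])
    also have "\<dots> = - \<gamma> * (r \<bullet> (A *v v)) / real CARD('m)"
      unfolding sum_distrib_left[symmetric] by (simp add: inner_vec_def)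
    finally show ?thesis
      by simp
  qed
  have "expectation (\<lambda>\<omega>. V \<omega> \<bullet> (X (Suc d) \<omega> - X d \<omega>))
      = expectation (\<lambda>\<omega>. g (V \<omega>, res (k d) \<omega>) (Z d \<omega>))"
    by (intro Bochner_Integration.integral_cong) (auto simp: X_Suc g_def split: prod.split)
  also have "\<dots> = - (\<gamma> / real CARD('m)) * expectation (\<lambda>\<omega>. res (k d) \<omega> \<bullet> (A *v V \<omega>))"
    using delay by (subst expectation_fresh_choice[OF past_Pair[OF V past_res]]) (auto simp: mean)
  finally show ?thesis .
qed

text \<open>The map \<open>f\<close> is left open to cover both \<open>A\<close>, where
  \<open>c\<close> is the square of \<open>alpha A\<close>, and the identity, where \<open>c\<close>
  is \<open>mu A\<close>. The factor \<open>theta A i\<close> cancels against the probability of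
  \<open>t\<close>.\<close>

lemma expectation_norm_increment:
  fixes f :: "real^'n \<Rightarrow> real^'c"
  assumes f: "linear f"
    and bound: "\<And>i. (\<Sum>t\<in>supp (row i A). (norm (f (update_dir A i t)))\<^sup>2) \<le> theta A i * c"
  shows "expectation (\<lambda>\<omega>. (norm (f (X (Suc d) \<omega> - X d \<omega>)))\<^sup>2)
    \<le> \<gamma>\<^sup>2 * c / real CARD('m) * err (k d)"
proof -
  define g where "g = (\<lambda>(r :: real^'m) (i, t). \<gamma>\<^sup>2 * (r $ i)\<^sup>2 * (norm (f (update_dir A i t)))\<^sup>2)"
  have mean: "measure_pmf.expectation (choice_pmf A) (g r) \<le> \<gamma>\<^sup>2 * c / real CARD('m) * (norm r)\<^sup>2"
    for r
  proof -
    have "(\<Sum>t\<in>supp (row i A). g r (i, t)) / theta A i \<le> \<gamma>\<^sup>2 * c * (r $ i)\<^sup>2" for i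
      using mult_left_mono[OF bound, of "\<gamma>\<^sup>2 * (r $ i)\<^sup>2" i] theta_pos[of i]
      by (simp add: g_def field_simps flip: sum_distrib_left)
    then have "(\<Sum>i\<in>UNIV. (\<Sum>t\<in>supp (row i A). g r (i, t)) / theta A i)
        \<le> (\<Sum>i\<in>UNIV. \<gamma>\<^sup>2 * c * (r $ i)\<^sup>2)"
      by (intro sum_mono)
    also have "\<dots> = \<gamma>\<^sup>2 * c * (norm r)\<^sup>2"
      unfolding power2_norm_eq_inner inner_vec_def by (simp add: power2_eq_square sum_distrib_left)
    finally show ?thesis
      unfolding expectation_choice_pmf[OF row_nonzero] by (simp add: divide_right_mono)
  qed
  have pr: "past d (res (k d))"
    using delay by (intro past_res)
  have "expectation (\<lambda>\<omega>. (norm (f (X (Suc d) \<omega> - X d \<omega>)))\<^sup>2)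
      = expectation (\<lambda>\<omega>. g (res (k d) \<omega>) (Z d \<omega>))"
    by (intro Bochner_Integration.integral_cong)
      (auto simp: X_Suc g_def linear_scale[OF f] linear_neg[OF f] power_mult_distrib split: prod.split)
  also have "\<dots> \<le> expectation (\<lambda>\<omega>. \<gamma>\<^sup>2 * c / real CARD('m) * (norm (res (k d) \<omega>))\<^sup>2)"
    unfolding expectation_fresh_choice[OF pr]
    by (intro integral_mono mean integrable_past[OF past_comp[OF pr]])
  finally show ?thesis
    by (simp add: err_def)
qed

text \<open>The difference telescopes, and \<open>V\<close>, determined by time \<open>p\<close>,
  lies in the past of every later increment.\<close>

lemma expectation_inner_increments:
  assumes V: "past p V" and "p \<le> j"
  shows "expectation (\<lambda>\<omega>. V \<omega> \<bullet> (X j \<omega> - X p \<omega>))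
    = - (\<gamma> / real CARD('m)) * (\<Sum>d\<in>{p..<j}. expectation (\<lambda>\<omega>. res (k d) \<omega> \<bullet> (A *v V \<omega>)))"
  using \<open>p \<le> j\<close>
proof (induction j rule: dec_induct)
  case (step j)
  have PV: "past (Suc j) V"
    using V step past_mono by (meson le_SucI)
  have i1: "integrable M (\<lambda>\<omega>. V \<omega> \<bullet> (X j \<omega> - X p \<omega>))"
    and i2: "integrable M (\<lambda>\<omega>. V \<omega> \<bullet> (X (Suc j) \<omega> - X j \<omega>))"
    using step by (auto intro!: integrable_past[where d = "Suc j"] past_comp2[where f = "(\<bullet>)"]
        past_comp2[where f = "(-)"] PV past_X')
  have "expectation (\<lambda>\<omega>. V \<omega> \<bullet> (X (Suc j) \<omega> - X p \<omega>))
      = expectation (\<lambda>\<omega>. V \<omega> \<bullet> (X j \<omega> - X p \<omega>) + V \<omega> \<bullet> (X (Suc j) \<omega> - X j \<omega>))"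
    by (intro Bochner_Integration.integral_cong) (auto simp: inner_simps)
  also have "\<dots> = expectation (\<lambda>\<omega>. V \<omega> \<bullet> (X j \<omega> - X p \<omega>))
      + expectation (\<lambda>\<omega>. V \<omega> \<bullet> (X (Suc j) \<omega> - X j \<omega>))"
    by (rule Bochner_Integration.integral_add[OF i1 i2])
  also have "expectation (\<lambda>\<omega>. V \<omega> \<bullet> (X (Suc j) \<omega> - X j \<omega>))
      = - (\<gamma> / real CARD('m)) * expectation (\<lambda>\<omega>. res (k j) \<omega> \<bullet> (A *v V \<omega>))"
    by (rule expectation_inner_increment[OF past_mono[OF V step.hyps(1)]])
  finally show ?case
    unfolding step.IH sum.atLeastLessThan_Suc[OF step.hyps(1)] by (simp only: distrib_left)
qed simp

end

section \<open>Residuals and distance to the solution set\<close>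

lemma geometric_growth_forward:
  fixes f :: "nat \<Rightarrow> real"
  assumes "\<And>i. p \<le> i \<Longrightarrow> i < q \<Longrightarrow> f (Suc i) \<le> \<rho> * f i"
    and "p \<le> q" "q \<le> p + N" "\<rho> \<ge> 1" "f p \<ge> 0"
  shows "f q \<le> \<rho> ^ N * f p"
proof -
  have "f q \<le> \<rho> ^ (q - p) * f p"
    using assms(2,1)
  proof (induction q rule: dec_induct)
    case (step q)
    then have "f (Suc q) \<le> \<rho> * f q" "f q \<le> \<rho> ^ (q - p) * f p"
      by auto
    with \<open>\<rho> \<ge> 1\<close> have "f (Suc q) \<le> \<rho> * (\<rho> ^ (q - p) * f p)"
      by (meson mult_left_mono order_trans zero_le_one)
    then show ?case
      using step by (simp add: Suc_diff_le mult.assoc)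
  qed simp
  also have "\<dots> \<le> \<rho> ^ N * f p"
    using assms by (intro mult_right_mono power_increasing) auto
  finally show ?thesis .
qed

text \<open>The one-step bound is asked only between \<open>p\<close> and \<open>q\<close>, so that
  the lemma applies inside an induction where later steps are still unknown. \<open>N\<close> is any
  bound on the distance, such as the maximal delay.\<close>

lemma geometric_growth_backward:
  fixes f :: "nat \<Rightarrow> real"
  assumes "\<And>i. p \<le> i \<Longrightarrow> i < q \<Longrightarrow> f i \<le> \<rho> * f (Suc i)"
    and "p \<le> q" "q \<le> p + N" "\<rho> \<ge> 1" "f q \<ge> 0"
  shows "f p \<le> \<rho> ^ N * f q"
proof -
  have "f p \<le> \<rho> ^ (q - p) * f q"
    using assms(2,1)
  proof (induction p rule: inc_induct)
    case (step p)
    then have "f p \<le> \<rho> * f (Suc p)" "f (Suc p) \<le> \<rho> ^ (q - Suc p) * f q"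
      by auto
    with \<open>\<rho> \<ge> 1\<close> have "f p \<le> \<rho> * (\<rho> ^ (q - Suc p) * f q)"
      by (meson mult_left_mono order_trans zero_le_one)
    also have "\<dots> = \<rho> ^ (q - p) * f q"
      using step.hyps by (simp add: Suc_diff_Suc flip: power_Suc mult.assoc)
    finally show ?case .
  qed simp
  also have "\<dots> \<le> \<rho> ^ N * f q"
    using assms by (intro mult_right_mono power_increasing) auto
  finally show ?thesis .
qed

lemma norm_add_squared: "(norm (x + y))\<^sup>2 = (norm x)\<^sup>2 + 2 * (x \<bullet> y) + (norm y)\<^sup>2"
  unfolding power2_norm_eq_inner by (simp add: inner_simps inner_commute)

lemma abs_inner_le_half_sum_squares: "\<bar>x \<bullet> y\<bar> \<le> ((norm x)\<^sup>2 + (norm y)\<^sup>2) / 2"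
  using Cauchy_Schwarz_ineq2[of x y] sum_squares_bound[of "norm x" "norm y"] by simp

section \<open>Recursion for the expected squared residual\<close>

context async_rk
begin

lemmas lambda_max_pos' = lambda_max_pos[OF A_nonzero]

lemma err_nonneg: "err d \<ge> 0"
  unfolding err_def by (intro integral_nonneg_AE) auto

text \<open>\<open>transpose A *v res p\<close> is the gradient of half the squared residual at
  \<open>X p\<close>. The delay enters the linear term of \<open>err (Suc d)\<close> as the mean
  inner product of two such gradients.\<close>

definition cross :: "nat \<Rightarrow> nat \<Rightarrow> real" where
  "cross p q = expectation (\<lambda>\<omega>. (transpose A *v res p \<omega>) \<bullet> (transpose A *v res q \<omega>))"

lemma past_pair_res: "past (max p q) (\<lambda>\<omega>. f (res p \<omega>) (res q \<omega>))"
  by (rule past_comp2[OF past_res past_res]) auto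

lemma integrable_res: "integrable M (\<lambda>\<omega>. f (res p \<omega>) (res q \<omega>) :: real)"
  by (rule integrable_past[OF past_pair_res])

lemma expectation_sum_res:
  "expectation (\<lambda>\<omega>. c * ((norm (res p \<omega>))\<^sup>2 + (norm (res q \<omega>))\<^sup>2)) = c * (err p + err q)"
proof -
  have "integrable M (\<lambda>\<omega>. (norm (res i \<omega>))\<^sup>2)" for i
    using integrable_res[of "\<lambda>x _. (norm x)\<^sup>2" i i] .
  then show ?thesis
    by (simp add: err_def)
qed

lemma abs_cross_le: "\<bar>cross p q\<bar> \<le> lambda_max A / 2 * (err p + err q)"
proof -
  have "\<bar>cross p q\<bar> \<le> expectation (\<lambda>\<omega>. \<bar>(transpose A *v res p \<omega>) \<bullet> (transpose A *v res q \<omega>)\<bar>)"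
    unfolding cross_def by (rule integral_abs_bound)
  also have "\<dots> \<le> expectation (\<lambda>\<omega>. lambda_max A / 2 * ((norm (res p \<omega>))\<^sup>2 + (norm (res q \<omega>))\<^sup>2))"
  proof (intro integral_mono integrable_res)
    fix \<omega>
    show "\<bar>(transpose A *v res p \<omega>) \<bullet> (transpose A *v res q \<omega>)\<bar>
      \<le> lambda_max A / 2 * ((norm (res p \<omega>))\<^sup>2 + (norm (res q \<omega>))\<^sup>2)"
      using abs_inner_le_half_sum_squares[of "transpose A *v res p \<omega>" "transpose A *v res q \<omega>"]
        norm_transpose_mult_le_lambda_max[of A "res p \<omega>"]
        norm_transpose_mult_le_lambda_max[of A "res q \<omega>"]
      by (simp add: algebra_simps)
  qed
  finally show ?thesis
    by (simp only: expectation_sum_res)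
qed

lemma res_diff: "res j \<omega> - res p \<omega> = A *v (X j \<omega> - X p \<omega>)"
  by (simp add: res_def matrix_vector_mult_diff_distrib)

text \<open>The square of \<open>res d\<close> plus \<open>A\<close> times the increment is
  expanded; the linear term can be averaged because \<open>res d\<close> is determined before the
  choice of iteration \<open>d\<close>.\<close>

lemma err_Suc:
  "err (Suc d) = err d - 2 * \<gamma> / real CARD('m) * cross d (k d)
    + expectation (\<lambda>\<omega>. (norm (A *v (X (Suc d) \<omega> - X d \<omega>)))\<^sup>2)"
proof -
  let ?D = "\<lambda>\<omega>. X (Suc d) \<omega> - X d \<omega>"
  have pointwise: "(norm (res (Suc d) \<omega>))\<^sup>2 =
      (norm (res d \<omega>))\<^sup>2 + 2 * ((transpose A *v res d \<omega>) \<bullet> ?D \<omega>) + (norm (A *v ?D \<omega>))\<^sup>2" for \<omega>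
  proof -
    have "res (Suc d) \<omega> = res d \<omega> + A *v ?D \<omega>"
      using res_diff[of "Suc d" \<omega> d] by (simp add: algebra_simps)
    then show ?thesis
      by (simp only: norm_add_squared inner_transpose_mult)
  qed
  have pD: "past (Suc d) ?D"
    by (intro past_comp2[where f = "(-)"] past_X') auto
  have "integrable M (\<lambda>\<omega>. (norm (res d \<omega>))\<^sup>2)"
    "integrable M (\<lambda>\<omega>. (transpose A *v res d \<omega>) \<bullet> ?D \<omega>)"
    "integrable M (\<lambda>\<omega>. (norm (A *v ?D \<omega>))\<^sup>2)"
    using integrable_past[OF past_comp[OF past_res[OF order_refl[of d]], of "\<lambda>x. (norm x)\<^sup>2"]]
      integrable_past[OF past_comp2[OF past_res pD, of d "\<lambda>r. (\<bullet>) (transpose A *v r)"]]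
      integrable_past[OF past_comp[OF pD, of "\<lambda>x. (norm (A *v x))\<^sup>2"]] by auto
  then have "err (Suc d) = err d + 2 * expectation (\<lambda>\<omega>. (transpose A *v res d \<omega>) \<bullet> ?D \<omega>)
      + expectation (\<lambda>\<omega>. (norm (A *v ?D \<omega>))\<^sup>2)"
    unfolding err_def pointwise
    by (simp only: Bochner_Integration.integral_add Bochner_Integration.integrable_add
        integrable_mult_right integral_mult_right_zero)
  also have "expectation (\<lambda>\<omega>. (transpose A *v res d \<omega>) \<bullet> ?D \<omega>)
      = - (\<gamma> / real CARD('m)) * cross d (k d)"
  proof -
    have "res (k d) \<omega> \<bullet> (A *v (transpose A *v res d \<omega>))
        = (transpose A *v res d \<omega>) \<bullet> (transpose A *v res (k d) \<omega>)" for \<omega>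
      by (subst inner_transpose_mult[symmetric]) (rule inner_commute)
    then show ?thesis
      unfolding cross_def
      by (simp only: expectation_inner_increment[OF past_comp[OF past_res[OF order_refl]], of "\<lambda>r. transpose A *v r"])
  qed
  finally show ?thesis
    by simp
qed

lemma expectation_norm_mult_increment:
  "expectation (\<lambda>\<omega>. (norm (A *v (X (Suc d) \<omega> - X d \<omega>)))\<^sup>2)
    \<le> \<gamma>\<^sup>2 * (alpha A)\<^sup>2 / real CARD('m) * err (k d)"
proof (rule expectation_norm_increment)
  fix i
  have "(\<Sum>t\<in>supp (row i A). (norm (A *v update_dir A i t))\<^sup>2) \<le> (\<Sum>t\<in>supp (row i A). (alpha A)\<^sup>2)"
    by (intro sum_mono power_mono norm_mult_dir_le_alpha) simp
  then show "(\<Sum>t\<in>supp (row i A). (norm (A *v update_dir A i t))\<^sup>2) \<le> theta A i * (alpha A)\<^sup>2"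
    by (simp add: theta_def norm0_def)
qed simp

lemma expectation_norm_iterate_increment:
  "expectation (\<lambda>\<omega>. (norm (X (Suc d) \<omega> - X d \<omega>))\<^sup>2) \<le> \<gamma>\<^sup>2 * mu A / real CARD('m) * err (k d)"
proof (rule expectation_norm_increment[where f = "\<lambda>x. x"])
  fix i
  show "(\<Sum>t\<in>supp (row i A). (norm (update_dir A i t))\<^sup>2) \<le> theta A i * mu A"
    unfolding sum_norm_dir using theta_le_mu[of A i] theta_nonneg[of A i]
    by (simp add: unit_rows power2_eq_square mult_left_mono)
qed (simp add: linear_iff)

text \<open>Expand \<open>X j - X p\<close> into its increments. AM-GM splits each resulting term so that one half is
  absorbed by the square of \<open>transpose A *v res p\<close>; only the delayed errors remain.\<close>

lemma cross_lower_bound: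
  assumes "p \<le> j" "j \<le> p + \<tau>" "\<gamma> \<ge> 0" and step: "\<gamma> * lambda_max A * real \<tau> \<le> real CARD('m)"
    and B: "\<And>d. p \<le> d \<Longrightarrow> d < j \<Longrightarrow> err (k d) \<le> B" "B \<ge> 0"
  shows "- (\<gamma> * real \<tau> * (lambda_max A)\<^sup>2 / (2 * real CARD('m))) * B \<le> cross j p"
proof -
  let ?L = "lambda_max A"
  let ?r = "\<lambda>\<omega>. transpose A *v res p \<omega>"
  let ?c = "\<gamma> / real CARD('m)"
  define a where "a = expectation (\<lambda>\<omega>. (norm (?r \<omega>))\<^sup>2)"
  have pr: "past p (\<lambda>\<omega>. f (res p \<omega>))" for f :: "real^'m \<Rightarrow> 'x"
    by (rule past_comp[OF past_res]) simp
  have "a \<ge> 0"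
    unfolding a_def by (intro integral_nonneg_AE) auto
  have summand: "expectation (\<lambda>\<omega>. res (k d) \<omega> \<bullet> (A *v (transpose A *v (A *v ?r \<omega>)))) \<le> ?L / 2 * a + ?L\<^sup>2 / 2 * B"
    if "p \<le> d" "d < j" for d
  proof -
    have "expectation (\<lambda>\<omega>. res (k d) \<omega> \<bullet> (A *v (transpose A *v (A *v ?r \<omega>))))
        \<le> expectation (\<lambda>\<omega>. ?L / 2 * (norm (?r \<omega>))\<^sup>2 + ?L\<^sup>2 / 2 * (norm (res (k d) \<omega>))\<^sup>2)"
    proof (intro integral_mono integrable_res)
      fix \<omega>
      \<comment> \<open>One \<open>A\<close> is put on each side of the product: the left factor
        costs \<open>?L\<^sup>2\<close> times a delayed error, the right one only \<open>?L\<close>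
        times the square of \<open>?r\<close>, which is absorbed at the end.\<close>
      have "res (k d) \<omega> \<bullet> (A *v (transpose A *v (A *v ?r \<omega>)))
          = (A *v (transpose A *v res (k d) \<omega>)) \<bullet> (A *v ?r \<omega>)"
        by (metis inner_commute inner_transpose_mult)
      also have "\<dots> \<le> ((norm (A *v (transpose A *v res (k d) \<omega>)))\<^sup>2 + (norm (A *v ?r \<omega>))\<^sup>2) / 2"
        using abs_inner_le_half_sum_squares by (rule order_trans[OF abs_ge_self])
      also have "\<dots> \<le> (?L * (?L * (norm (res (k d) \<omega>))\<^sup>2) + ?L * (norm (?r \<omega>))\<^sup>2) / 2"
        using mult_left_mono[OF norm_transpose_mult_le_lambda_max[of A "res (k d) \<omega>"]] lambda_max_pos'
        by (intro divide_right_mono add_mono order_trans[OF norm_mult_le_lambda_max]) auto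
      finally show "res (k d) \<omega> \<bullet> (A *v (transpose A *v (A *v ?r \<omega>)))
          \<le> ?L / 2 * (norm (?r \<omega>))\<^sup>2 + ?L\<^sup>2 / 2 * (norm (res (k d) \<omega>))\<^sup>2"
        by (simp add: power2_eq_square add_divide_distrib)
    qed
    also have "\<dots> = ?L / 2 * a + ?L\<^sup>2 / 2 * err (k d)"
      unfolding a_def err_def
      by (subst Bochner_Integration.integral_add) (auto intro!: integrable_res)
    finally show ?thesis
      using B(1)[OF that] by (smt (verit) mult_left_mono zero_le_power2 divide_nonneg_nonneg)
  qed
  have "cross j p = expectation (\<lambda>\<omega>. (norm (?r \<omega>))\<^sup>2 + (transpose A *v (A *v ?r \<omega>)) \<bullet> (X j \<omega> - X p \<omega>))"
    unfolding cross_def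
  proof (intro Bochner_Integration.integral_cong refl)
    fix \<omega>
    have "(transpose A *v (A *v ?r \<omega>)) \<bullet> (X j \<omega> - X p \<omega>) = ?r \<omega> \<bullet> (transpose A *v (res j \<omega> - res p \<omega>))"
      by (metis res_diff inner_transpose_mult inner_commute)
    then show "(transpose A *v res j \<omega>) \<bullet> ?r \<omega>
        = (norm (?r \<omega>))\<^sup>2 + (transpose A *v (A *v ?r \<omega>)) \<bullet> (X j \<omega> - X p \<omega>)"
      by (simp add: matrix_vector_mult_diff_distrib power2_norm_eq_inner inner_simps inner_commute)
  qed
  also have "\<dots> = a + expectation (\<lambda>\<omega>. (transpose A *v (A *v ?r \<omega>)) \<bullet> (X j \<omega> - X p \<omega>))"
    unfolding a_def
    by (intro Bochner_Integration.integral_add integrable_past[where d = j] past_comp2[where f = "(\<bullet>)"]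
        past_comp2[where f = "(-)"] past_X' past_mono[OF pr] \<open>p \<le> j\<close> order_refl)
  also have "\<dots> = a - ?c * (\<Sum>d\<in>{p..<j}. expectation (\<lambda>\<omega>. res (k d) \<omega> \<bullet> (A *v (transpose A *v (A *v ?r \<omega>)))))"
    by (simp only: expectation_inner_increments[OF pr[of "\<lambda>r. transpose A *v (A *v (transpose A *v r))"] \<open>p \<le> j\<close>]
        mult_minus_left add_uminus_conv_diff)
  finally have eq: "cross j p = \<dots>" .
  have "(\<Sum>d\<in>{p..<j}. expectation (\<lambda>\<omega>. res (k d) \<omega> \<bullet> (A *v (transpose A *v (A *v ?r \<omega>)))))
      \<le> real (j - p) * (?L / 2 * a + ?L\<^sup>2 / 2 * B)"
    using sum_mono[of "{p..<j}", OF summand] by simp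
  also have "\<dots> \<le> real \<tau> * (?L / 2 * a + ?L\<^sup>2 / 2 * B)"
    using assms lambda_max_pos' \<open>a \<ge> 0\<close> by (intro mult_right_mono) auto
  finally have "cross j p \<ge> a - ?c * (real \<tau> * (?L / 2 * a + ?L\<^sup>2 / 2 * B))"
    unfolding eq using \<open>\<gamma> \<ge> 0\<close> by (intro diff_left_mono mult_left_mono) auto
  also have "a - ?c * (real \<tau> * (?L / 2 * a + ?L\<^sup>2 / 2 * B))
      = a * (1 - \<gamma> * ?L * real \<tau> / real CARD('m) / 2) - \<gamma> * real \<tau> * ?L\<^sup>2 / (2 * real CARD('m)) * B"
    by (simp add: field_simps)
  finally have *: "cross j p \<ge> a * (1 - \<gamma> * ?L * real \<tau> / real CARD('m) / 2)
      - \<gamma> * real \<tau> * ?L\<^sup>2 / (2 * real CARD('m)) * B" .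
  have "\<gamma> * ?L * real \<tau> / real CARD('m) \<le> 1"
    using step by (simp add: divide_le_eq)
  then have "0 \<le> a * (1 - \<gamma> * ?L * real \<tau> / real CARD('m) / 2)"
    using \<open>a \<ge> 0\<close> by (intro mult_nonneg_nonneg) auto
  with * show ?thesis
    by simp
qed

text \<open>Writing \<open>res j\<close> as \<open>res p\<close> plus increments makes iteration
  \<open>d\<close> contribute a multiple of \<open>cross (k d) p\<close>, which
  \<open>abs_cross_le\<close> bounds. There is no square to absorb one half, so \<open>err p\<close>
  stays in the bound.\<close>

lemma inner_res_lower_bound:
  assumes "p \<le> j" "j \<le> p + \<tau>" "\<gamma> \<ge> 0"
    and B: "\<And>d. p \<le> d \<Longrightarrow> d < j \<Longrightarrow> err (k d) \<le> B" "B \<ge> 0"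
  shows "err p - \<gamma> * lambda_max A * real \<tau> / (2 * real CARD('m)) * (err p + B)
    \<le> expectation (\<lambda>\<omega>. res p \<omega> \<bullet> res j \<omega>)"
proof -
  let ?L = "lambda_max A"
  let ?r = "\<lambda>\<omega>. transpose A *v res p \<omega>"
  let ?c = "\<gamma> / real CARD('m)"
  have pr: "past p (\<lambda>\<omega>. f (res p \<omega>))" for f :: "real^'m \<Rightarrow> 'x"
    by (rule past_comp[OF past_res]) simp
  have summand: "expectation (\<lambda>\<omega>. res (k d) \<omega> \<bullet> (A *v ?r \<omega>)) \<le> ?L / 2 * (err p + B)"
    if "p \<le> d" "d < j" for d
  proof -
    have "expectation (\<lambda>\<omega>. res (k d) \<omega> \<bullet> (A *v ?r \<omega>)) = cross (k d) p"
      unfolding cross_def by (simp add: inner_transpose_mult)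
    also have "\<dots> \<le> ?L / 2 * (err (k d) + err p)"
      using abs_cross_le by (rule order_trans[OF abs_ge_self])
    also have "\<dots> \<le> ?L / 2 * (err p + B)"
      using B(1)[OF that] lambda_max_pos' by (intro mult_left_mono) auto
    finally show ?thesis .
  qed
  have "expectation (\<lambda>\<omega>. res p \<omega> \<bullet> res j \<omega>) = expectation (\<lambda>\<omega>. (norm (res p \<omega>))\<^sup>2 + ?r \<omega> \<bullet> (X j \<omega> - X p \<omega>))"
  proof (intro Bochner_Integration.integral_cong refl)
    fix \<omega>
    have "?r \<omega> \<bullet> (X j \<omega> - X p \<omega>) = res p \<omega> \<bullet> (res j \<omega> - res p \<omega>)"
      by (simp add: res_diff inner_transpose_mult)
    then show "res p \<omega> \<bullet> res j \<omega> = (norm (res p \<omega>))\<^sup>2 + ?r \<omega> \<bullet> (X j \<omega> - X p \<omega>)"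
      by (simp add: power2_norm_eq_inner inner_simps)
  qed
  also have "\<dots> = err p + expectation (\<lambda>\<omega>. ?r \<omega> \<bullet> (X j \<omega> - X p \<omega>))"
    unfolding err_def
    by (intro Bochner_Integration.integral_add integrable_past[where d = j] past_comp2[where f = "(\<bullet>)"]
        past_comp2[where f = "(-)"] past_X' past_mono[OF pr] \<open>p \<le> j\<close> order_refl)
  also have "\<dots> = err p - ?c * (\<Sum>d\<in>{p..<j}. expectation (\<lambda>\<omega>. res (k d) \<omega> \<bullet> (A *v ?r \<omega>)))"
    by (simp only: expectation_inner_increments[OF pr[of "\<lambda>r. transpose A *v r"] \<open>p \<le> j\<close>]
        mult_minus_left add_uminus_conv_diff)
  finally have eq: "expectation (\<lambda>\<omega>. res p \<omega> \<bullet> res j \<omega>) = \<dots>" .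
  have "(\<Sum>d\<in>{p..<j}. expectation (\<lambda>\<omega>. res (k d) \<omega> \<bullet> (A *v ?r \<omega>))) \<le> real (j - p) * (?L / 2 * (err p + B))"
    using sum_mono[of "{p..<j}", OF summand] by simp
  also have "\<dots> \<le> real \<tau> * (?L / 2 * (err p + B))"
    using assms lambda_max_pos' err_nonneg[of p] by (intro mult_right_mono) auto
  finally have "expectation (\<lambda>\<omega>. res p \<omega> \<bullet> res j \<omega>) \<ge> err p - ?c * (real \<tau> * (?L / 2 * (err p + B)))"
    unfolding eq using \<open>\<gamma> \<ge> 0\<close> by (intro diff_left_mono mult_left_mono) auto
  then show ?thesis
    by (simp add: field_simps)
qed

lemma err_le_err_Suc:
  assumes "\<rho> > 1" "\<gamma> > 0"
    and "\<gamma> \<le> real CARD('m) * (\<rho> - 1) / (2 * lambda_max A * \<rho> ^ (\<tau> + 1))"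
  shows "err d \<le> \<rho> * err (Suc d)"
proof (induction d rule: less_induct)
  case (less d)
  let ?s = "2 * \<gamma> * lambda_max A * \<rho> ^ \<tau> / real CARD('m)"
  \<comment> \<open>The bound on \<gamma> rearranged: \<open>1 - ?s\<close> is at least the
    reciprocal of \<rho>.\<close>
  have s: "\<rho> * ?s \<le> \<rho> - 1"
    using assms lambda_max_pos' by (simp add: field_simps)
  \<comment> \<open>The induction hypothesis covers all steps from \<open>k d\<close> to
    \<open>d\<close>, of which there are at most \<tau>.\<close>
  have "err (k d) \<le> \<rho> ^ \<tau> * err d"
    using less assms delay err_nonneg by (intro geometric_growth_backward) auto
  moreover have "err d \<le> \<rho> ^ \<tau> * err d"
    using mult_right_mono[OF one_le_power[of \<rho> \<tau>] err_nonneg[of d]] assms by simp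
  ultimately have "lambda_max A / 2 * (err d + err (k d)) \<le> lambda_max A / 2 * (2 * (\<rho> ^ \<tau> * err d))"
    using lambda_max_pos' by (intro mult_left_mono) auto
  then have "cross d (k d) \<le> lambda_max A * \<rho> ^ \<tau> * err d"
    using abs_cross_le[of d "k d"] by simp
  then have "2 * \<gamma> / real CARD('m) * cross d (k d) \<le> 2 * \<gamma> / real CARD('m) * (lambda_max A * \<rho> ^ \<tau> * err d)"
    using assms by (intro mult_left_mono) auto
  then have upper: "2 * \<gamma> / real CARD('m) * cross d (k d) \<le> ?s * err d"
    by (simp add: mult_ac)
  \<comment> \<open>The quadratic term of \<open>err_Suc\<close> only helps a lower bound and is
    discarded.\<close>
  have "0 \<le> expectation (\<lambda>\<omega>. (norm (A *v (X (Suc d) \<omega> - X d \<omega>)))\<^sup>2)"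
    by (intro integral_nonneg_AE) auto
  then have "err d - ?s * err d \<le> err (Suc d)"
    using err_Suc[of d] upper by linarith
  then have "\<rho> * (err d - ?s * err d) \<le> \<rho> * err (Suc d)"
    using assms by (intro mult_left_mono) auto
  moreover have "(\<rho> * ?s) * err d \<le> (\<rho> - 1) * err d"
    using s err_nonneg by (rule mult_right_mono)
  ultimately show ?case
    by (simp add: algebra_simps)
qed

lemma err_Suc_le:
  assumes "\<rho> > 1" "\<gamma> > 0" and grow_back: "\<And>d. err d \<le> \<rho> * err (Suc d)"
    and step: "\<gamma> * lambda_max A * real \<tau> \<le> real CARD('m)"
    and step2: "\<gamma>\<^sup>2 * (\<rho> ^ \<tau> * (real CARD('m) * (alpha A)\<^sup>2 + (lambda_max A)\<^sup>2 * real \<tau> * \<rho> ^ \<tau>))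
      \<le> (real CARD('m))\<^sup>2 * (\<rho> - 1)"
  shows "err (Suc d) \<le> \<rho> * err d"
proof -
  let ?m = "real CARD('m)"
  \<comment> \<open>Two delays add up: \<open>i\<close> is at least \<open>k d\<close>, and
    \<open>k i\<close> trails \<open>i\<close> by at most \<tau>, so \<open>k i\<close> lies at most
    \<open>2 * \<tau>\<close> before \<open>d\<close>.\<close>
  have "err (k i) \<le> \<rho> ^ (\<tau> + \<tau>) * err d" if "k d \<le> i" "i < d" for i
    using grow_back assms err_nonneg delay[of d] delay[of i] that by (intro geometric_growth_backward) auto
  then have "- (\<gamma> * real \<tau> * (lambda_max A)\<^sup>2 / (2 * ?m)) * (\<rho> ^ (\<tau> + \<tau>) * err d) \<le> cross d (k d)"
    using assms err_nonneg delay by (intro cross_lower_bound) auto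
  from mult_left_mono[OF this, of "2 * \<gamma> / ?m"]
  have 1: "- (2 * \<gamma> / ?m * cross d (k d)) \<le> \<gamma>\<^sup>2 * real \<tau> * (lambda_max A)\<^sup>2 * \<rho> ^ (\<tau> + \<tau>) / ?m\<^sup>2 * err d"
    using \<open>\<gamma> > 0\<close> by (simp add: power2_eq_square algebra_simps)
  have "err (k d) \<le> \<rho> ^ \<tau> * err d"
    using grow_back assms delay err_nonneg by (intro geometric_growth_backward) auto
  from mult_left_mono[OF this, of "\<gamma>\<^sup>2 * (alpha A)\<^sup>2 / ?m"]
  have 2: "\<gamma>\<^sup>2 * (alpha A)\<^sup>2 / ?m * err (k d) \<le> \<gamma>\<^sup>2 * (alpha A)\<^sup>2 * \<rho> ^ \<tau> / ?m * err d"
    by (simp add: mult_ac)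
  have "err (Suc d) \<le> err d + \<gamma>\<^sup>2 * real \<tau> * (lambda_max A)\<^sup>2 * \<rho> ^ (\<tau> + \<tau>) / ?m\<^sup>2 * err d
      + \<gamma>\<^sup>2 * (alpha A)\<^sup>2 * \<rho> ^ \<tau> / ?m * err d"
    using err_Suc[of d] expectation_norm_mult_increment[of d] 1 2 by linarith
  also have "\<dots> = err d + \<gamma>\<^sup>2 * (\<rho> ^ \<tau> * (?m * (alpha A)\<^sup>2 + (lambda_max A)\<^sup>2 * real \<tau> * \<rho> ^ \<tau>)) / ?m\<^sup>2 * err d"
    by (simp add: power_add field_simps power2_eq_square)
  \<comment> \<open>\<open>step2\<close> says precisely that the two contributions together have a
    coefficient of at most \<open>\<rho> - 1\<close>.\<close>
  also have "\<dots> \<le> err d + (\<rho> - 1) * err d"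
    using step2 err_nonneg by (intro add_left_mono mult_right_mono) (auto simp: divide_le_eq mult_ac)
  finally show ?thesis
    by (simp add: algebra_simps)
qed

section \<open>Expected squared distance to the solution set\<close>

definition sol_dist :: "nat \<Rightarrow> real" where
  "sol_dist d = expectation (\<lambda>\<omega>. (norm (X d \<omega> - closest_point (solutions A b) (X d \<omega>)))\<^sup>2)"

lemma sol_dist_nonneg: "sol_dist d \<ge> 0"
  unfolding sol_dist_def by (intro integral_nonneg_AE) auto

lemma past_iterate: "past d (\<lambda>\<omega>. f (X d \<omega>))"
  by (rule past_comp[OF past_X])

text \<open>The offset from the projection is orthogonal to the kernel and \<open>A\<close> maps it
  to the residual, so \<open>lambda_min_le_norm_mult\<close> applies pointwise.\<close>

lemma lambda_min_sol_dist_le: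
  assumes "solutions A b \<noteq> {}"
  shows "lambda_min A * sol_dist d \<le> err d"
proof -
  have "lambda_min A * sol_dist d
      = expectation (\<lambda>\<omega>. lambda_min A * (norm (X d \<omega> - closest_point (solutions A b) (X d \<omega>)))\<^sup>2)"
    by (simp add: sol_dist_def)
  also have "\<dots> \<le> err d"
    unfolding err_def
  proof (intro integral_mono integrable_past[OF past_iterate] integrable_past[OF past_comp[OF past_res[OF order_refl]]])
    fix \<omega>
    let ?y = "X d \<omega> - closest_point (solutions A b) (X d \<omega>)"
    have "A *v ?y = res d \<omega>"
      by (simp add: matrix_vector_mult_diff_distrib closest_point_in_solutions[OF assms] res_def)
    then show "lambda_min A * (norm ?y)\<^sup>2 \<le> (norm (res d \<omega>))\<^sup>2"
      using lambda_min_le_norm_mult[of A ?y] closest_point_solutions_orthogonal[OF assms] by simp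
  qed
  finally show ?thesis .
qed

text \<open>The new iterate is compared with the projection of the old one, a solution but perhaps
  not the nearest. The old offset is determined by the past, so the linear term can be
  averaged.\<close>

lemma sol_dist_Suc_le:
  assumes ne: "solutions A b \<noteq> {}"
  shows "sol_dist (Suc d) \<le> sol_dist d
    - 2 * \<gamma> / real CARD('m) * expectation (\<lambda>\<omega>. res (k d) \<omega> \<bullet> res d \<omega>)
    + \<gamma>\<^sup>2 * mu A / real CARD('m) * err (k d)"
proof -
  let ?D = "\<lambda>\<omega>. X (Suc d) \<omega> - X d \<omega>"
  let ?y = "\<lambda>\<omega>. X d \<omega> - closest_point (solutions A b) (X d \<omega>)"
  have pD: "past (Suc d) ?D"
    by (intro past_comp2[where f = "(-)"] past_X') auto
  have py: "past (Suc d) ?y"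
    by (rule past_mono[OF past_iterate]) simp
  note ints = integrable_past[OF past_comp[OF py, of "\<lambda>x. (norm x)\<^sup>2"]]
    integrable_past[OF past_comp2[OF py pD, of "(\<bullet>)"]]
    integrable_past[OF past_comp[OF pD, of "\<lambda>x. (norm x)\<^sup>2"]]
  have Ay: "A *v ?y \<omega> = res d \<omega>" for \<omega>
    by (simp add: matrix_vector_mult_diff_distrib closest_point_in_solutions[OF ne] res_def)
  have "sol_dist (Suc d) \<le> expectation (\<lambda>\<omega>. (norm (?y \<omega>))\<^sup>2 + 2 * (?y \<omega> \<bullet> ?D \<omega>) + (norm (?D \<omega>))\<^sup>2)"
    unfolding sol_dist_def
  proof (intro integral_mono integrable_past[OF past_iterate] Bochner_Integration.integrable_add
      integrable_mult_right ints)
    fix \<omega>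
    let ?p = "closest_point (solutions A b) (X d \<omega>)"
    have "?p \<in> solutions A b"
      using closest_point_in_solutions[OF ne] by (simp add: solutions_def)
    then have "norm (X (Suc d) \<omega> - closest_point (solutions A b) (X (Suc d) \<omega>)) \<le> norm (X (Suc d) \<omega> - ?p)"
      using closest_point_le[OF closed_solutions[OF ne], of ?p "X (Suc d) \<omega>"] by (simp add: dist_norm)
    then have "(norm (X (Suc d) \<omega> - closest_point (solutions A b) (X (Suc d) \<omega>)))\<^sup>2
        \<le> (norm (?y \<omega> + ?D \<omega>))\<^sup>2"
      by (intro power_mono) auto
    also have "\<dots> = (norm (?y \<omega>))\<^sup>2 + 2 * (?y \<omega> \<bullet> ?D \<omega>) + (norm (?D \<omega>))\<^sup>2"
      by (rule norm_add_squared)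
    finally show "(norm (X (Suc d) \<omega> - closest_point (solutions A b) (X (Suc d) \<omega>)))\<^sup>2 \<le> \<dots>" .
  qed
  also have "\<dots> = sol_dist d + 2 * expectation (\<lambda>\<omega>. ?y \<omega> \<bullet> ?D \<omega>) + expectation (\<lambda>\<omega>. (norm (?D \<omega>))\<^sup>2)"
    unfolding sol_dist_def
    by (simp only: ints Bochner_Integration.integral_add Bochner_Integration.integrable_add
        integrable_mult_right integral_mult_right_zero)
  also have "expectation (\<lambda>\<omega>. ?y \<omega> \<bullet> ?D \<omega>)
      = - (\<gamma> / real CARD('m)) * expectation (\<lambda>\<omega>. res (k d) \<omega> \<bullet> res d \<omega>)"
    using expectation_inner_increment[OF past_iterate, of "\<lambda>x. x - closest_point (solutions A b) x" d]
    by (simp only: Ay)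
  finally show ?thesis
    using expectation_norm_iterate_increment[of d] by simp
qed

lemma sol_dist_decrease:
  assumes ne: "solutions A b \<noteq> {}" and "\<rho> > 1" "\<gamma> > 0"
    and grow_back: "\<And>d. err d \<le> \<rho> * err (Suc d)" and grow_forth: "\<And>d. err (Suc d) \<le> \<rho> * err d"
  shows "sol_dist (Suc d) \<le> sol_dist d - \<gamma> / real CARD('m) * (2 - \<gamma> * psi A \<tau> \<rho>) * err (k d)"
proof -
  let ?m = "real CARD('m)"
  \<comment> \<open>The index \<open>k i\<close> may lie before or after \<open>k d\<close>, in
    either case within distance \<tau>; hence both directions of growth are used.\<close>
  have B: "err (k i) \<le> \<rho> ^ \<tau> * err (k d)" if "k d \<le> i" "i < d" for i
  proof (cases "k i \<le> k d")
    case True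
    then show ?thesis
      using grow_back assms(2) err_nonneg delay[of i] that by (intro geometric_growth_backward) auto
  next
    case False
    then show ?thesis
      using grow_forth assms(2) err_nonneg delay[of i] delay[of d] that by (intro geometric_growth_forward) auto
  qed
  \<comment> \<open>Enlarging \<open>1 + \<rho> ^ \<tau>\<close> to
    \<open>2 * \<rho> ^ \<tau>\<close> produces the factor \<open>2\<close> in
    \<open>psi\<close>.\<close>
  have "err (k d) \<le> \<rho> ^ \<tau> * err (k d)"
    using mult_right_mono[OF one_le_power[of \<rho> \<tau>] err_nonneg[of "k d"]] assms(2) by simp
  then have "\<gamma> * lambda_max A * real \<tau> / (2 * ?m) * (err (k d) + \<rho> ^ \<tau> * err (k d))
      \<le> \<gamma> * lambda_max A * real \<tau> / (2 * ?m) * (2 * \<rho> ^ \<tau> * err (k d))"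
    using assms(3) lambda_max_pos' by (intro mult_left_mono) auto
  moreover have "err (k d) - \<gamma> * lambda_max A * real \<tau> / (2 * ?m) * (err (k d) + \<rho> ^ \<tau> * err (k d))
      \<le> expectation (\<lambda>\<omega>. res (k d) \<omega> \<bullet> res d \<omega>)"
    using assms(2,3) delay err_nonneg B by (intro inner_res_lower_bound) auto
  ultimately have "err (k d) - \<gamma> * lambda_max A * real \<tau> / (2 * ?m) * (2 * \<rho> ^ \<tau> * err (k d))
      \<le> expectation (\<lambda>\<omega>. res (k d) \<omega> \<bullet> res d \<omega>)"
    by linarith
  from mult_left_mono[OF this, of "2 * \<gamma> / ?m"]
  have "2 * \<gamma> / ?m * (err (k d) - \<gamma> * lambda_max A * real \<tau> / (2 * ?m) * (2 * \<rho> ^ \<tau> * err (k d)))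
      \<le> 2 * \<gamma> / ?m * expectation (\<lambda>\<omega>. res (k d) \<omega> \<bullet> res d \<omega>)"
    using assms(3) by simp
  with sol_dist_Suc_le[OF ne, of d]
  have "sol_dist (Suc d) \<le> sol_dist d
      - 2 * \<gamma> / ?m * (err (k d) - \<gamma> * lambda_max A * real \<tau> / (2 * ?m) * (2 * \<rho> ^ \<tau> * err (k d)))
      + \<gamma>\<^sup>2 * mu A / ?m * err (k d)"
    by linarith
  also have "\<dots> = sol_dist d - \<gamma> / ?m * (2 - \<gamma> * psi A \<tau> \<rho>) * err (k d)"
    by (simp add: psi_def field_simps power2_eq_square)
  finally show ?thesis .
qed

text \<open>As \<open>\<gamma> * psi A \<tau> \<rho>\<close> is at most \<open>1\<close>, the
  coefficient of the delayed error is nonnegative, so \<open>sol_dist\<close> is nonincreasing. Its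
  value at \<open>k d\<close> is then at least that at \<open>d\<close>, which removes the
  delay.\<close>

lemma sol_dist_contract:
  assumes ne: "solutions A b \<noteq> {}" and "\<gamma> > 0" and psi: "\<gamma> * psi A \<tau> \<rho> \<le> 1"
    and decr: "\<And>d. sol_dist (Suc d) \<le> sol_dist d - \<gamma> / real CARD('m) * (2 - \<gamma> * psi A \<tau> \<rho>) * err (k d)"
  shows "sol_dist j \<le> (1 - lambda_min A * \<gamma> / real CARD('m) * (2 - \<gamma> * psi A \<tau> \<rho>)) ^ j * sol_dist 0"
proof -
  let ?c = "\<gamma> / real CARD('m) * (2 - \<gamma> * psi A \<tau> \<rho>)"
  let ?q = "1 - lambda_min A * \<gamma> / real CARD('m) * (2 - \<gamma> * psi A \<tau> \<rho>)"
  have "?c \<ge> 0"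
    using assms by (intro mult_nonneg_nonneg divide_nonneg_nonneg) auto
  have "sol_dist (Suc d) \<le> sol_dist d" for d
    using decr[of d] mult_nonneg_nonneg[OF \<open>?c \<ge> 0\<close> err_nonneg[of "k d"]] by linarith
  then have antimono: "sol_dist d' \<le> sol_dist d" if "d \<le> d'" for d d'
    using lift_Suc_antimono_le[of sol_dist] that by blast
  have contract: "sol_dist (Suc d) \<le> ?q * sol_dist d" for d
  proof -
    have "lambda_min A * sol_dist d \<le> lambda_min A * sol_dist (k d)"
      using lambda_min_nonneg[OF A_nonzero] antimono delay by (intro mult_left_mono) auto
    also have "\<dots> \<le> err (k d)"
      by (rule lambda_min_sol_dist_le[OF ne])
    finally have "?c * (lambda_min A * sol_dist d) \<le> ?c * err (k d)"
      using \<open>?c \<ge> 0\<close> by (rule mult_left_mono)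
    with decr[of d] have "sol_dist (Suc d) \<le> sol_dist d - ?c * (lambda_min A * sol_dist d)"
      by linarith
    also have "\<dots> = ?q * sol_dist d"
      by (simp add: algebra_simps)
    finally show ?thesis .
  qed
  \<comment> \<open>Nonnegativity of the contraction factor is not assumed; it follows from \<open>contract\<close> at \<open>0\<close>.\<close>
  show ?thesis
  proof (cases "sol_dist 0 = 0")
    case True
    then show ?thesis
      using antimono[of 0 j] by simp
  next
    case False
    then have "?q \<ge> 0"
      using contract[of 0] sol_dist_nonneg[of 0] sol_dist_nonneg[of 1]
      by (smt (verit) One_nat_def mult_neg_pos)
    show ?thesis
    proof (induction j)
      case (Suc j)
      have "sol_dist (Suc j) \<le> ?q * (?q ^ j * sol_dist 0)"
        using contract[of j] mult_left_mono[OF Suc \<open>?q \<ge> 0\<close>] by linarith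
      then show ?case
        by (simp add: mult.assoc)
    qed simp
  qed
qed

end

section \<open>From the step-length bounds to the two estimates\<close>

theorem theorem1:
  fixes A :: "real^'n^'m" and b :: "real^'m" and x0 :: "real^'n"
    and \<tau> :: nat and \<gamma> \<rho> :: real and k :: "nat \<Rightarrow> nat"
    and M :: "'w measure" and I :: "nat \<Rightarrow> 'w \<Rightarrow> 'm" and T :: "nat \<Rightarrow> 'w \<Rightarrow> 'n"
    and X :: "nat \<Rightarrow> 'w \<Rightarrow> real^'n" and j :: nat
  assumes "prob_space M"
    and "\<And>i. norm (row i A) = 1"
    and "\<exists>x. A *v x = b"
    and "\<tau> \<ge> 1"
    and "async_kaczmarz M A b \<tau> \<gamma> x0 k I T X"
    and "\<rho> > 1"
    and "\<gamma> > 0"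
    and "\<gamma> \<le> 1 / psi A \<tau> \<rho>"
    and "\<gamma> \<le> real CARD('m) * (\<rho> - 1) / (2 * lambda_max A * \<rho> ^ (\<tau> + 1))"
    and "\<gamma> \<le> real CARD('m) * sqrt ((\<rho> - 1) /
           (\<rho> ^ \<tau> * (real CARD('m) * (alpha A)\<^sup>2 + (lambda_max A)\<^sup>2 * real \<tau> * \<rho> ^ \<tau>)))"
  shows "inverse \<rho> * (\<integral>\<omega>. (norm (A *v X j \<omega> - b))\<^sup>2 \<partial>M)
           \<le> (\<integral>\<omega>. (norm (A *v X (j + 1) \<omega> - b))\<^sup>2 \<partial>M) \<and>
         (\<integral>\<omega>. (norm (A *v X (j + 1) \<omega> - b))\<^sup>2 \<partial>M)
           \<le> \<rho> * (\<integral>\<omega>. (norm (A *v X j \<omega> - b))\<^sup>2 \<partial>M) \<and>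
         (\<integral>\<omega>. (norm (X j \<omega> - closest_point (solutions A b) (X j \<omega>)))\<^sup>2 \<partial>M)
           \<le> (1 - lambda_min A * \<gamma> / real CARD('m) * (2 - \<gamma> * psi A \<tau> \<rho>)) ^ j
              * (norm (x0 - closest_point (solutions A b) x0))\<^sup>2"
proof -
  interpret async_rk M A b \<tau> \<gamma> x0 k I T X
    using assms by (simp add: async_rk_def async_rk_axioms_def)
  let ?m = "real CARD('m)" and ?L = "lambda_max A"
  have ne: "solutions A b \<noteq> {}"
    using assms(3) by (auto simp: solutions_def)
  have grow_back: "err d \<le> \<rho> * err (Suc d)" for d
    using assms by (intro err_le_err_Suc) auto
  have "mu A \<ge> 0"
    using theta_nonneg theta_le_mu order_trans by blast
  \<comment> \<open>Positivity allows the bound by \<open>1 / psi A \<tau> \<rho>\<close> to be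
    multiplied out.\<close>
  then have "psi A \<tau> \<rho> > 0"
    unfolding psi_def using assms(4,6) lambda_max_pos'
    by (intro add_nonneg_pos divide_pos_pos mult_pos_pos) auto
  then have psi: "\<gamma> * psi A \<tau> \<rho> \<le> 1"
    using assms(8) by (simp add: field_simps)
  \<comment> \<open>This condition is hidden in the first bound:
    \<open>?L * real \<tau> / ?m\<close> is below the second summand of \<open>psi\<close>, because
    \<open>2 * \<rho> ^ \<tau>\<close> exceeds \<open>1\<close>.\<close>
  have step: "\<gamma> * ?L * real \<tau> \<le> ?m"
  proof -
    have "?L * real \<tau> * 1 \<le> ?L * real \<tau> * \<rho> ^ \<tau>"
      using lambda_max_pos' assms(6) by (intro mult_left_mono) auto
    also have "\<dots> \<le> 2 * ?L * real \<tau> * \<rho> ^ \<tau>"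
      using lambda_max_pos' assms(6) by auto
    finally have "?L * real \<tau> / ?m \<le> psi A \<tau> \<rho>"
      unfolding psi_def using \<open>mu A \<ge> 0\<close> by (intro add_increasing divide_right_mono) auto
    then have "\<gamma> * (?L * real \<tau> / ?m) \<le> 1"
      using psi assms(7) by (meson less_imp_le mult_left_mono order_trans)
    then show ?thesis
      by (simp add: field_simps)
  qed
  let ?R = "\<rho> ^ \<tau> * (?m * (alpha A)\<^sup>2 + ?L\<^sup>2 * real \<tau> * \<rho> ^ \<tau>)"
  have "?R > 0"
    using lambda_max_pos' assms(4,6) by (intro mult_pos_pos add_nonneg_pos) auto
  \<comment> \<open>The third bound enters in squared form, cleared of the root and of the positive
    denominator \<open>?R\<close>.\<close>
  have "\<gamma>\<^sup>2 \<le> (?m * sqrt ((\<rho> - 1) / ?R))\<^sup>2"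
    using assms(7,10) by (intro power_mono) auto
  also have "\<dots> = ?m\<^sup>2 * ((\<rho> - 1) / ?R)"
    using \<open>?R > 0\<close> assms(6) by (simp add: power_mult_distrib)
  finally have step2: "\<gamma>\<^sup>2 * ?R \<le> ?m\<^sup>2 * (\<rho> - 1)"
    using \<open>?R > 0\<close> by (simp add: pos_le_divide_eq)
  have grow_forth: "err (Suc d) \<le> \<rho> * err d" for d
    by (rule err_Suc_le[OF assms(6,7) grow_back step step2])
  have "sol_dist j \<le> (1 - lambda_min A * \<gamma> / ?m * (2 - \<gamma> * psi A \<tau> \<rho>)) ^ j * sol_dist 0"
    by (rule sol_dist_contract[OF ne assms(7) psi sol_dist_decrease[OF ne assms(6,7) grow_back grow_forth]])
  moreover have "sol_dist 0 = (norm (x0 - closest_point (solutions A b) x0))\<^sup>2"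
    unfolding sol_dist_def by (simp add: X_0 prob_space cong: Bochner_Integration.integral_cong)
  moreover have "inverse \<rho> * err j \<le> err (Suc j)"
    using grow_back[of j] assms(6) by (simp add: field_simps)
  ultimately show ?thesis
    using grow_forth[of j] by (simp add: err_def res_def sol_dist_def)
qed

end
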